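(* Let the interconnected system $\dot y=h(y)$, $y=(x,z)\in\mathbb{R}^n\times\mathbb{R}^m$, $h=(f,g)$, and the functions $V,W,\lambda_x,\lambda_z$ be as in the context. Assume that: (local data) the region-dependent gain condition holds for $(\underline M,\overline M,\underline N,\overline N,\gamma,\delta)=(0,M_\ell,0,N_\ell,\gamma_\ell,\delta_\ell)$, where $M_\ell<\infty$ or $N_\ell<\infty$; (non-local data) the region-dependent gain condition holds for $(\underline M,\overline M,\underline N,\overline N,\gamma,\delta)=(M_g,\infty,N_g,\infty,\gamma_g,\delta_g)$, where $M_g>0$ or $N_g>0$; and that $M_\ell<M_g$ or $N_\ell<N_g$. Let $U_\ell$ and $\widehat M_\ell=\min\{\delta_\ell(M_\ell),N_\ell\}$ be the function and the constant given by the existence result (P) of the context for the local data, let $U_g$ and $\widetilde M_g=\max\{\gamma_g^{-1}(M_g),N_g\}$ be the function and the constant given by (P) for the non-local data, and let $$\mathbf{R}=\mathrm{cl}\big\{\{y:U_g(y)\le\widetilde M_g\}\setminus\{y:U_\ell(y)\le\widehat M_\ell\}\big\}.$$ If there exists a function $\rho\in C^1(\mathbb{R}^{n+m}\setminus\{0\},\mathbb{R}_{\ge0})$ with $\operatorname{supp}(\rho)\supseteq\mathbf{R}$ and such that, for every $y\in\mathbf{R}$, $\operatorname{div}(h\rho)(y)>0$, then the origin is almost globally asymptotically stable for $\dot y=h(y)$.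
   Context: Notation. $\mathcal{K}_\infty$ is the class of continuous, strictly increasing, unbounded functions $\gamma:\mathbb{R}_{\ge0}\to\mathbb{R}_{\ge0}$ with $\gamma(0)=0$. A continuous function $\varphi:\mathbb{R}^k\to\mathbb{R}$ is positive definite if $\varphi(0)=0$ and $\varphi(x)>0$ for $x\neq0$; it is proper if $|\varphi(x)|\to\infty$ as $|x|\to\infty$. $\operatorname{supp}(\rho)$ denotes the set $\{y:\rho(y)\ne0\}$, and $\mathrm{cl}$ denotes closure. Conventions: $\delta(\infty)=\infty$ for $\delta\in\mathcal{K}_\infty$; constraints "$\le\infty$" are void. System. $f\in C^1(\mathbb{R}^{n+m},\mathbb{R}^n)$, $g\in C^1(\mathbb{R}^{n+m},\mathbb{R}^m)$, $n,m\ge1$. The interconnected system is $\dot x=f(x,z)$, $\dot z=g(x,z)$, written $\dot y=h(y)$ with $y=(x,z)$; $Y(t,y)$ is its solution at time $t$ starting from $y$. The origin is input-to-state stable (ISS) for each of the subsystems $\dot x=f(x,u)$ (input $u$) and $\dot z=g(v,z)$ (input $v$). Dini derivatives. $D^+_fV(x,z)=\limsup_{\tau\searrow0}\frac{V(x+\tau f(x,z))-V(x)}{\tau}$ and $D^+_gW(x,z)=\limsup_{\tau\searrow0}\frac{W(z+\tau g(x,z))-W(z)}{\tau}$. Storage functions. $V:\mathbb{R}^n\to\mathbb{R}_{\ge0}$ and $W:\mathbb{R}^m\to\mathbb{R}_{\ge0}$ are locally Lipschitz, each bounded below and above by $\mathcal{K}_\infty$ functions of the norm of its argument. They are ISS-Lyapunov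 functions for the two subsystems: there are a continuous, positive definite, proper function $\lambda_x:\mathbb{R}^n\to\mathbb{R}_{\ge0}$, a continuous, positive definite function $\lambda_z:\mathbb{R}^m\to\mathbb{R}_{\ge0}$, and $\alpha_x,\alpha_z\in\mathcal{K}_\infty$ such that for all $(x,z)$: $|x|\ge\alpha_x(|z|)\Rightarrow D_f^+V(x,z)\le-\lambda_x(x)$, and $W(z)\ge\alpha_z(|x|)\Rightarrow D_g^+W(x,z)\le-\lambda_z(z)$. Region-dependent gain condition for $(\underline M,\overline M,\underline N,\overline N,\gamma,\delta)$, where $0\le\underline M<\overline M\le\infty$, $0\le\underline N<\overline N\le\infty$, $\gamma,\delta\in\mathcal{K}_\infty$: (i) for every $(x,z)\in\mathbf{S}$, $V(x)\ge\gamma(W(z))\Rightarrow D_f^+V(x,z)\le-\lambda_x(x)$ and $W(z)\ge\delta(V(x))\Rightarrow D_g^+W(x,z)\le-\lambda_z(z)$, where $\mathbf{S}=\{(x,z):\underline M\le V(x)\le\overline M,\ W(z)\le\overline N\}\cup\{(x,z):V(x)\le\overline M,\ \underline N\le W(z)\le\overline N\}$; (ii) $\gamma\circ\delta(s)<s$ for all $s\in[\underline M,\overline M]\setminus\{0\}$ if $\overline M<\infty$, and for all $s\in[\underline M,\infty)\setminus\{0\}$ if $\overline M=\infty$. Existence result (P). Suppose the region-dependent gain condition holds for $(\underline M,\overline M,\underline N,\overline N,\gamma,\delta)$ and $\widetilde M:=\max\{\gamma^{-1}(\underline M),\underline N\}<\min\{\delta(\overline M),\overline N\}=:\widehat M$.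 Then there exists a proper, positive definite function $U:\mathbb{R}^{n+m}\to\mathbb{R}_{\ge0}$, locally Lipschitz on $\mathbb{R}^{n+m}\setminus\{0\}$, such that $\limsup_{t\to\infty}U(Y(t,y))\le\widetilde M$ for every $y$ with $\widetilde M<U(y)\le\widehat M$. Moreover, if $\gamma,\delta$ are also $C^1$, a suitable $U$ is $U(x,z)=\max\{\tfrac12(\delta(V(x))+\gamma^{-1}(V(x))),\,W(z)\}$. (For the local data $\widetilde M=0$, and for the non-local data $\widehat M=\infty$, so the inequality $\widetilde M<\widehat M$ holds automatically in both cases.) Almost global asymptotic stability. The origin is almost globally asymptotically stable if it is locally stable in the sense of Lyapunov and there is a set $\aleph\subset\mathbb{R}^{n+m}$ of Lebesgue measure zero such that $\lim_{t\to\infty}|Y(t,y)|=0$ for every $y\in\mathbb{R}^{n+m}\setminus\aleph$. *)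

theory Defs
  imports "HOL-Analysis.Analysis" "HOL-Probability.Essential_Supremum"
begin

section \<open>Function classes\<close>

text \<open>Comparison functions are total functions on the reals of which only the restriction to
  \<open>{0..}\<close> is relevant.\<close>

definition class_Kinf :: "(real \<Rightarrow> real) \<Rightarrow> bool" where
  "class_Kinf \<gamma> \<longleftrightarrow> continuous_on {0..} \<gamma> \<and> strict_mono_on {0..} \<gamma> \<and> \<gamma> 0 = 0 \<and>
     (\<forall>r. \<exists>s\<ge>0. r < \<gamma> s)"

definition class_KL :: "(real \<Rightarrow> real \<Rightarrow> real) \<Rightarrow> bool" where
  "class_KL \<beta> \<longleftrightarrow> continuous_on ({0..} \<times> {0..}) (\<lambda>(r, t). \<beta> r t) \<and>
     (\<forall>t\<ge>0. \<beta> 0 t = 0 \<and> strict_mono_on {0..} (\<lambda>r. \<beta> r t)) \<and>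
     (\<forall>r\<ge>0. antimono_on {0..} (\<beta> r) \<and> (\<beta> r \<longlongrightarrow> 0) at_top)"

definition Kinf_inverse :: "(real \<Rightarrow> real) \<Rightarrow> real \<Rightarrow> real" where
  "Kinf_inverse \<gamma> = the_inv_into {0..} \<gamma>"

text \<open>Extension by \<open>\<delta>(\<infinity>) = \<infinity>\<close>; used for arguments in \<open>[0, \<infinity>]\<close> only.\<close>

definition Kinf_extend :: "(real \<Rightarrow> real) \<Rightarrow> ereal \<Rightarrow> ereal" where
  "Kinf_extend \<delta> s = (if s = \<infinity> then \<infinity> else ereal (\<delta> (real_of_ereal s)))"

definition positive_definite :: "('a::real_normed_vector \<Rightarrow> real) \<Rightarrow> bool" where
  "positive_definite \<phi> \<longleftrightarrow> continuous_on UNIV \<phi> \<and> \<phi> 0 = 0 \<and> (\<forall>x. x \<noteq> 0 \<longrightarrow> 0 < \<phi> x)"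

definition proper_function :: "('a::real_normed_vector \<Rightarrow> real) \<Rightarrow> bool" where
  "proper_function \<phi> \<longleftrightarrow> filterlim (\<lambda>x. \<bar>\<phi> x\<bar>) at_top at_infinity"

text \<open>The dummy time parameter only serves to reuse the library's parametrised notion.\<close>

definition locally_lipschitz_on :: "'a::metric_space set \<Rightarrow> ('a \<Rightarrow> 'b::metric_space) \<Rightarrow> bool" where
  "locally_lipschitz_on S F \<longleftrightarrow> local_lipschitz (UNIV :: real set) S (\<lambda>_. F)"

text \<open>Intended for open \<open>S\<close>.\<close>

definition C1_on :: "'a::euclidean_space set \<Rightarrow> ('a \<Rightarrow> 'b::euclidean_space) \<Rightarrow> bool" where
  "C1_on S F \<longleftrightarrow> (\<exists>F' :: 'a \<Rightarrow> 'a \<Rightarrow>\<^sub>L 'b.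
     (\<forall>y\<in>S. (F has_derivative blinfun_apply (F' y)) (at y)) \<and> continuous_on S F')"

definition divergence_at :: "('a::euclidean_space \<Rightarrow> 'a) \<Rightarrow> 'a \<Rightarrow> real" where
  "divergence_at F y = (\<Sum>b\<in>Basis. frechet_derivative F (at y) b \<bullet> b)"

section \<open>Dynamics\<close>

definition interconnection :: "('a \<times> 'b \<Rightarrow> 'a) \<Rightarrow> ('a \<times> 'b \<Rightarrow> 'b) \<Rightarrow> 'a \<times> 'b \<Rightarrow> 'a \<times> 'b" where
  "interconnection f g = (\<lambda>y. (f y, g y))"

text \<open>\<open>\<phi> t = Y(t, y)\<close> for all \<open>t \<ge> 0\<close>. For a \<open>C\<^sup>1\<close> field there is at most one such \<open>\<phi>\<close> on
  \<open>{0..}\<close>, and its existence means that the maximal solution from \<open>y\<close> has no finite escape time.\<close>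

definition forward_solution :: "('a::real_normed_vector \<Rightarrow> 'a) \<Rightarrow> 'a \<Rightarrow> (real \<Rightarrow> 'a) \<Rightarrow> bool" where
  "forward_solution h y \<phi> \<longleftrightarrow>
     \<phi> 0 = y \<and> (\<forall>t\<ge>0. (\<phi> has_vector_derivative h (\<phi> t)) (at t within {0..}))"

text \<open>Inputs are measurable and locally essentially bounded, solutions are in the sense of
  Caratheodory. Over the null set \<open>{0..0}\<close> the essential supremum is \<open>-\<infinity>\<close>, which
  \<open>real_of_ereal\<close> sends to \<open>0\<close>.\<close>

definition sup_norm_upto :: "real \<Rightarrow> (real \<Rightarrow> 'b::euclidean_space) \<Rightarrow> ereal" where
  "sup_norm_upto t u = esssup (lebesgue_on {0..t}) (\<lambda>s. ereal (norm (u s)))"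

definition admissible_input :: "(real \<Rightarrow> 'b::euclidean_space) \<Rightarrow> bool" where
  "admissible_input u \<longleftrightarrow> u \<in> borel_measurable (lebesgue_on {0..}) \<and>
     (\<forall>t\<ge>0. sup_norm_upto t u < \<infinity>)"

definition controlled_solution ::
  "('a::euclidean_space \<Rightarrow> 'b::euclidean_space \<Rightarrow> 'a) \<Rightarrow> (real \<Rightarrow> 'b) \<Rightarrow> 'a \<Rightarrow> (real \<Rightarrow> 'a) \<Rightarrow> bool" where
  "controlled_solution F u x0 \<phi> \<longleftrightarrow> continuous_on {0..} \<phi> \<and>
     (\<forall>t\<ge>0. set_integrable lebesgue {0..t} (\<lambda>s. F (\<phi> s) (u s)) \<and>
            \<phi> t = x0 + (LINT s:{0..t}|lebesgue. F (\<phi> s) (u s)))"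

definition input_to_state_stable ::
  "('a::euclidean_space \<Rightarrow> 'b::euclidean_space \<Rightarrow> 'a) \<Rightarrow> bool" where
  "input_to_state_stable F \<longleftrightarrow> (\<exists>\<beta> \<kappa>. class_KL \<beta> \<and> class_Kinf \<kappa> \<and>
     (\<forall>x0 u. admissible_input u \<longrightarrow>
        (\<exists>\<phi>. controlled_solution F u x0 \<phi> \<and>
          (\<forall>t\<ge>0. norm (\<phi> t) \<le> \<beta> (norm x0) t + \<kappa> (real_of_ereal (sup_norm_upto t u))))))"

definition lyapunov_stable :: "('a::euclidean_space \<Rightarrow> 'a) \<Rightarrow> bool" where
  "lyapunov_stable h \<longleftrightarrow> (\<forall>\<epsilon>>0. \<exists>r>0. \<forall>y. norm y < r \<longrightarrow>
     (\<exists>\<phi>. forward_solution h y \<phi> \<and> (\<forall>t\<ge>0. norm (\<phi> t) < \<epsilon>)))"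

definition almost_globally_asymptotically_stable :: "('a::euclidean_space \<Rightarrow> 'a) \<Rightarrow> bool" where
  "almost_globally_asymptotically_stable h \<longleftrightarrow> lyapunov_stable h \<and>
     (\<exists>N \<in> null_sets lebesgue. \<forall>y. y \<notin> N \<longrightarrow>
        (\<exists>\<phi>. forward_solution h y \<phi> \<and> ((\<lambda>t. norm (\<phi> t)) \<longlongrightarrow> 0) at_top))"

section \<open>Storage functions\<close>

definition dini_derivative :: "('a::real_normed_vector \<Rightarrow> real) \<Rightarrow> 'a \<Rightarrow> 'a \<Rightarrow> ereal" where
  "dini_derivative V x v = Limsup (at_right 0) (\<lambda>\<tau>. ereal ((V (x + \<tau> *\<^sub>R v) - V x) / \<tau>))"

definition storage_function :: "('a::real_normed_vector \<Rightarrow> real) \<Rightarrow> bool" where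
  "storage_function V \<longleftrightarrow> (\<forall>x. 0 \<le> V x) \<and> locally_lipschitz_on UNIV V \<and>
     (\<exists>a b. class_Kinf a \<and> class_Kinf b \<and> (\<forall>x. a (norm x) \<le> V x \<and> V x \<le> b (norm x)))"

text \<open>The two implications are deliberately not symmetric: the first compares \<open>\<bar>x\<bar>\<close>, the
  second \<open>W z\<close>, with the gain; likewise only \<open>lam_x\<close> is required to be proper.\<close>

definition iss_lyapunov_pair ::
  "('a::euclidean_space \<times> 'b::euclidean_space \<Rightarrow> 'a) \<Rightarrow> ('a \<times> 'b \<Rightarrow> 'b) \<Rightarrow>
   ('a \<Rightarrow> real) \<Rightarrow> ('b \<Rightarrow> real) \<Rightarrow> ('a \<Rightarrow> real) \<Rightarrow> ('b \<Rightarrow> real) \<Rightarrow> bool" where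
  "iss_lyapunov_pair f g V W lam_x lam_z \<longleftrightarrow>
     storage_function V \<and> storage_function W \<and>
     positive_definite lam_x \<and> proper_function lam_x \<and> positive_definite lam_z \<and>
     (\<exists>\<alpha>x \<alpha>z. class_Kinf \<alpha>x \<and> class_Kinf \<alpha>z \<and>
       (\<forall>x z.
         (\<alpha>x (norm z) \<le> norm x \<longrightarrow> dini_derivative V x (f (x, z)) \<le> ereal (- lam_x x)) \<and>
         (\<alpha>z (norm x) \<le> W z \<longrightarrow> dini_derivative W z (g (x, z)) \<le> ereal (- lam_z z))))"

section \<open>Region-dependent gain condition\<close>

definition gain_region ::
  "('a \<Rightarrow> real) \<Rightarrow> ('b \<Rightarrow> real) \<Rightarrow> real \<Rightarrow> ereal \<Rightarrow> real \<Rightarrow> ereal \<Rightarrow> ('a \<times> 'b) set" where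
  "gain_region V W M_lo M_up N_lo N_up =
     {(x, z). M_lo \<le> V x \<and> ereal (V x) \<le> M_up \<and> ereal (W z) \<le> N_up} \<union>
     {(x, z). ereal (V x) \<le> M_up \<and> N_lo \<le> W z \<and> ereal (W z) \<le> N_up}"

definition region_gain_condition ::
  "('a::euclidean_space \<times> 'b::euclidean_space \<Rightarrow> 'a) \<Rightarrow> ('a \<times> 'b \<Rightarrow> 'b) \<Rightarrow>
   ('a \<Rightarrow> real) \<Rightarrow> ('b \<Rightarrow> real) \<Rightarrow> ('a \<Rightarrow> real) \<Rightarrow> ('b \<Rightarrow> real) \<Rightarrow>
   real \<Rightarrow> ereal \<Rightarrow> real \<Rightarrow> ereal \<Rightarrow> (real \<Rightarrow> real) \<Rightarrow> (real \<Rightarrow> real) \<Rightarrow> bool" where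
  "region_gain_condition f g V W lam_x lam_z M_lo M_up N_lo N_up \<gamma> \<delta> \<longleftrightarrow>
     0 \<le> M_lo \<and> ereal M_lo < M_up \<and> 0 \<le> N_lo \<and> ereal N_lo < N_up \<and>
     class_Kinf \<gamma> \<and> class_Kinf \<delta> \<and>
     (\<forall>(x, z) \<in> gain_region V W M_lo M_up N_lo N_up.
        (\<gamma> (W z) \<le> V x \<longrightarrow> dini_derivative V x (f (x, z)) \<le> ereal (- lam_x x)) \<and>
        (\<delta> (V x) \<le> W z \<longrightarrow> dini_derivative W z (g (x, z)) \<le> ereal (- lam_z z))) \<and>
     (\<forall>s. M_lo \<le> s \<and> ereal s \<le> M_up \<and> s \<noteq> 0 \<longrightarrow> \<gamma> (\<delta> s) < s)"

definition lower_level :: "(real \<Rightarrow> real) \<Rightarrow> real \<Rightarrow> real \<Rightarrow> real" where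
  "lower_level \<gamma> M_lo N_lo = max (Kinf_inverse \<gamma> M_lo) N_lo"

definition upper_level :: "(real \<Rightarrow> real) \<Rightarrow> ereal \<Rightarrow> ereal \<Rightarrow> ereal" where
  "upper_level \<delta> M_up N_up = min (Kinf_extend \<delta> M_up) N_up"

text \<open>The properties which the existence result for the region-dependent gain condition
  guarantees for the function \<open>U\<close> between the levels \<open>m\<close> and \<open>M\<close>.\<close>

definition region_lyapunov_function ::
  "('a::euclidean_space \<Rightarrow> 'a) \<Rightarrow> real \<Rightarrow> ereal \<Rightarrow> ('a \<Rightarrow> real) \<Rightarrow> bool" where
  "region_lyapunov_function h m M U \<longleftrightarrow>
     (\<forall>y. 0 \<le> U y) \<and> proper_function U \<and> positive_definite U \<and> locally_lipschitz_on (- {0}) U \<and>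
     (\<forall>y. m < U y \<and> ereal (U y) \<le> M \<longrightarrow>
        (\<exists>\<phi>. forward_solution h y \<phi> \<and> Limsup at_top (\<lambda>t. ereal (U (\<phi> t))) \<le> ereal m))"

definition density_region ::
  "('a::euclidean_space \<Rightarrow> real) \<Rightarrow> ereal \<Rightarrow> ('a \<Rightarrow> real) \<Rightarrow> real \<Rightarrow> 'a set" where
  "density_region U\<^sub>l M\<^sub>l U\<^sub>g m\<^sub>g = closure ({y. U\<^sub>g y \<le> m\<^sub>g} - {y. ereal (U\<^sub>l y) \<le> M\<^sub>l})"

end

theory Submission
  imports Defs "HOL-Probability.Probability_Measure"
begin

text \<open>Solutions exist globally because they either stay in the compact sublevel set of \<open>U\<^sub>g\<close> or reach the region
  where global existence is part of the hypotheses on \<open>U\<^sub>g\<close>. Stability of the origin follows from the local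
  gain condition, which makes arbitrarily small boxes \<open>V \<le> a\<close>, \<open>W \<le> b\<close> forward invariant. A solution that
  does not converge to the origin never meets the sublevel set of \<open>U\<^sub>l\<close>, so its limit points lie in \<open>R\<close> and it finally
  stays in a compact neighbourhood \<open>K\<close> of \<open>R\<close> on which \<open>div (\<rho> h) > 0\<close>. The set \<open>S\<close> of points whose
  solutions stay in \<open>K\<close> is compact and forward invariant. Such a set is null without any use of a smooth
  flow: for the cutoffs \<open>\<psi>\<^sub>k = max 0 (1 - k dist(y, S))\<close> invariance gives \<open>\<nabla>\<psi>\<^sub>k \<bullet> h \<ge> - L\<close> off \<open>S\<close>
  and \<open>\<ge> 0\<close> on \<open>S\<close>, where \<open>L\<close> is a Lipschitz constant of \<open>h\<close>; hence
  \<open>\<integral> \<psi>\<^sub>k div (\<rho> h) = - \<integral> \<rho> \<nabla>\<psi>\<^sub>k \<bullet> h\<close> is at most \<open>L\<close> times the \<open>\<rho>\<close>-mass of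
  \<open>0 < dist(y, S) < 1 / k\<close>, and \<open>\<integral>\<^bsub>S\<^esub> div (\<rho> h) \<le> 0\<close> in the limit. Finally, non-convergent initial values
  are preimages of \<open>S\<close> under maps with Lipschitz inverses.\<close>

section \<open>Continuously differentiable maps\<close>

text \<open>A direct transport argument would follow the measure \<open>\<rho> dy\<close> along a
  differentiable flow. Here every solution turns out to be bounded, so all estimates live on compact
  sets, and two-sided Gronwall bounds do the work of the flow map. The existence result (P) shapes
  the rest: it yields some solution and a limsup, but neither decay of \<open>U\<close> nor
  invariance of its sublevel sets. Attraction by \<open>U_l\<close> therefore does not give
  stability, which has to come from \<open>V\<close> and \<open>W\<close>; and tails of solutions
  have to be studied through their limit points. The delicate limit points are those exactly on the
  level \<open>U_l = M\<close>. They are not excluded by the bad solution avoiding the sublevel set;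
  instead the solution from such a point is followed until \<open>U_l\<close> is strictly below the
  level, and continuous dependence drags the bad solution along. A bad solution need not enter
  \<open>R\<close>, only approach it. Since \<open>R\<close> is compact and misses the origin and
  the divergence is continuous, its positivity survives on a compact neighbourhood, and that
  neighbourhood is where the trapped set lives.\<close>

lemma C1_on_continuous_on: "C1_on S F \<Longrightarrow> continuous_on S F"
  unfolding C1_on_def continuous_on_eq_continuous_within
  using has_derivative_continuous[OF has_derivative_at_withinI] by fast

lemma C1_on_subset:
  assumes "C1_on S F" "T \<subseteq> S"
  shows "C1_on T F"
proof -
  obtain F' where F': "\<forall>y\<in>S. (F has_derivative blinfun_apply (F' y)) (at y)" "continuous_on S F'"
    using assms(1) unfolding C1_on_def by blast
  show ?thesis
    unfolding C1_on_def
  proof (intro exI conjI ballI)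
    show "(F has_derivative blinfun_apply (F' y)) (at y)" if "y \<in> T" for y
      using F'(1) assms(2) that by blast
    show "continuous_on T F'" by (rule continuous_on_subset[OF F'(2) assms(2)])
  qed
qed

lemma C1_on_Pair:
  fixes f :: "'a::euclidean_space \<Rightarrow> 'b::euclidean_space" and g :: "'a \<Rightarrow> 'c::euclidean_space"
  assumes "C1_on S f" "C1_on S g"
  shows "C1_on S (\<lambda>y. (f y, g y))"
proof -
  obtain f' where f': "\<forall>y\<in>S. (f has_derivative blinfun_apply (f' y)) (at y)" "continuous_on S f'"
    using assms(1) unfolding C1_on_def by blast
  obtain g' where g': "\<forall>y\<in>S. (g has_derivative blinfun_apply (g' y)) (at y)" "continuous_on S g'"
    using assms(2) unfolding C1_on_def by blast
  \<comment> \<open>The two coordinate injections as bounded linear maps: composing with them makes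
    the derivative of the pair a continuous expression in \<open>f'\<close> and
    \<open>g'\<close>.\<close>
  define i where "i = Blinfun (\<lambda>x. (x :: 'b, 0 :: 'c))"
  define j where "j = Blinfun (\<lambda>x. (0 :: 'b, x :: 'c))"
  have i: "blinfun_apply i x = (x, 0)" and j: "blinfun_apply j z = (0, z)" for x z
    unfolding i_def j_def
    by (simp_all add: bounded_linear_Blinfun_apply bounded_linear_Pair bounded_linear_ident bounded_linear_zero)
  have "((\<lambda>y. (f y, g y)) has_derivative blinfun_apply ((i o\<^sub>L f' y) + (j o\<^sub>L g' y))) (at y)" if "y \<in> S" for y
  proof -
    have "((\<lambda>y. (f y, g y)) has_derivative (\<lambda>v. (f' y v, g' y v))) (at y)"
      using f' g' that by (intro has_derivative_Pair) auto
    moreover have "(\<lambda>v. (f' y v, g' y v)) = blinfun_apply ((i o\<^sub>L f' y) + (j o\<^sub>L g' y))"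
      by (simp add: fun_eq_iff blinfun.add_left i j)
    ultimately show ?thesis by simp
  qed
  moreover have "continuous_on S (\<lambda>y. (i o\<^sub>L f' y) + (j o\<^sub>L g' y))"
    using f'(2) g'(2) by (intro continuous_intros)
  ultimately show ?thesis
    unfolding C1_on_def by (intro exI[of _ "\<lambda>y. (i o\<^sub>L f' y) + (j o\<^sub>L g' y)"] conjI ballI)
qed

lemma C1_on_scaleR:
  fixes h :: "'a::euclidean_space \<Rightarrow> 'b::euclidean_space"
  assumes "C1_on S \<rho>" "C1_on S h"
  shows "C1_on S (\<lambda>y. \<rho> y *\<^sub>R h y)"
proof -
  obtain \<rho>' where \<rho>': "\<forall>y\<in>S. (\<rho> has_derivative blinfun_apply (\<rho>' y)) (at y)" "continuous_on S \<rho>'"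
    using assms(1) unfolding C1_on_def by blast
  obtain h' where h': "\<forall>y\<in>S. (h has_derivative blinfun_apply (h' y)) (at y)" "continuous_on S h'"
    using assms(2) unfolding C1_on_def by blast
  define G' where "G' y = \<rho> y *\<^sub>R h' y + (blinfun_scaleR_left (h y) o\<^sub>L \<rho>' y)" for y
  have "((\<lambda>y. \<rho> y *\<^sub>R h y) has_derivative blinfun_apply (G' y)) (at y)" if "y \<in> S" for y
  proof -
    have "((\<lambda>y. \<rho> y *\<^sub>R h y) has_derivative (\<lambda>v. \<rho> y *\<^sub>R h' y v + \<rho>' y v *\<^sub>R h y)) (at y)"
      using \<rho>' h' that by (intro has_derivative_scaleR) auto
    moreover have "(\<lambda>v. \<rho> y *\<^sub>R h' y v + \<rho>' y v *\<^sub>R h y) = blinfun_apply (G' y)"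
      by (simp add: fun_eq_iff G'_def blinfun.add_left blinfun.scaleR_left)
    ultimately show ?thesis by simp
  qed
  moreover have "continuous_on S G'"
    unfolding G'_def
    using \<rho>'(2) h'(2) C1_on_continuous_on[OF assms(1)] C1_on_continuous_on[OF assms(2)]
    by (intro continuous_intros bounded_linear.continuous_on[OF bounded_linear_blinfun_scaleR_left])
  ultimately show ?thesis
    unfolding C1_on_def by (intro exI[of _ G'] conjI ballI)
qed

lemma C1_on_lipschitz_on_cball:
  fixes h :: "'a::euclidean_space \<Rightarrow> 'b::euclidean_space"
  assumes "C1_on UNIV h"
  shows "\<exists>L. L-lipschitz_on (cball 0 r) h"
proof -
  obtain h' where h': "\<And>y. (h has_derivative blinfun_apply (h' y)) (at y)" "continuous_on UNIV h'"
    using assms unfolding C1_on_def by auto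
  have "compact (h' ` cball 0 r)"
    using h'(2) by (intro compact_continuous_image) (auto intro: continuous_on_subset)
  then obtain B where B: "\<And>y. y \<in> cball 0 r \<Longrightarrow> norm (h' y) \<le> B"
    using compact_imp_bounded by (force simp: bounded_iff)
  \<comment> \<open>For \<open>r < 0\<close> the ball is empty and \<open>B\<close> may be negative,
    while a Lipschitz constant has to be nonnegative.\<close>
  have "(max B 0)-lipschitz_on (cball 0 r) h"
  proof (rule bounded_derivative_imp_lipschitz)
    show "(h has_derivative blinfun_apply (h' y)) (at y within cball 0 r)" for y
      using h'(1) by (rule has_derivative_at_withinI)
    show "onorm (blinfun_apply (h' y)) \<le> max B 0" if "y \<in> cball 0 r" for y
      using B[OF that] by (simp add: norm_blinfun.rep_eq)
  qed auto
  then show ?thesis by blast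
qed

section \<open>Forward solutions\<close>

lemma forward_solution_continuous_on:
  "forward_solution h y \<phi> \<Longrightarrow> continuous_on {0..} \<phi>"
  unfolding forward_solution_def
  by (auto simp: continuous_on_eq_continuous_within intro: has_vector_derivative_continuous)

lemma forward_solution_shift:
  assumes "forward_solution h y \<phi>" "0 \<le> s"
  shows "forward_solution h (\<phi> s) (\<lambda>t. \<phi> (s + t))"
  unfolding forward_solution_def
proof (intro conjI allI impI)
  fix t :: real assume t: "0 \<le> t"
  have "(\<phi> has_vector_derivative h (\<phi> (s + t))) (at (s + t) within {0..})"
    using assms t unfolding forward_solution_def by simp
  then have "(\<phi> has_vector_derivative h (\<phi> (s + t))) (at (s + t) within (+) s ` {0..})"
    by (rule has_vector_derivative_within_subset) (use assms in auto)
  moreover have "((+) s has_vector_derivative 1) (at t within {0..})"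
    by (auto intro!: derivative_eq_intros)
  ultimately show "((\<lambda>t. \<phi> (s + t)) has_vector_derivative h (\<phi> (s + t))) (at t within {0..})"
    using vector_diff_chain_within[of "(+) s" 1 t "{0..}" \<phi> "h (\<phi> (s + t))"] by (simp add: o_def)
qed simp

text \<open>The equation is autonomous and both pieces pass through \<open>\<phi> T\<close>, so at
  the joint both one-sided derivatives equal \<open>h (\<phi> T)\<close>.\<close>

lemma forward_solution_splice:
  assumes T: "0 \<le> T" and \<phi>0: "\<phi> 0 = y"
    and \<phi>: "\<And>t. t \<in> {0..T} \<Longrightarrow> (\<phi> has_vector_derivative h (\<phi> t)) (at t within {0..T})"
    and \<psi>: "forward_solution h (\<phi> T) \<psi>"
  shows "forward_solution h y (\<lambda>t. if t \<le> T then \<phi> t else \<psi> (t - T))"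
  unfolding forward_solution_def
proof (intro conjI allI impI)
  show "(if 0 \<le> T then \<phi> 0 else \<psi> (0 - T)) = y"
    using T \<phi>0 by simp
  let ?\<chi> = "\<lambda>t. if t \<in> {0..T} then \<phi> t else \<psi> (t - T)"
  let ?\<chi>' = "\<lambda>t. if t \<in> {0..T} then h (\<phi> t) else h (\<psi> (t - T))"
  have \<psi>0: "\<psi> 0 = \<phi> T" using \<psi> by (simp add: forward_solution_def)
  fix t :: real assume t: "0 \<le> t"
  have *: "{0..T} \<union> {T..} = {0..}" using T by auto
  have "(?\<chi> has_vector_derivative ?\<chi>' t) (at t within {0..})"
  proof (rule has_vector_derivative_If_within_closures[of t "{0..T}" "{T..}" "{0..}" \<phi> "\<lambda>t. h (\<phi> t)" "\<lambda>t. \<psi> (t - T)" "\<lambda>t. h (\<psi> (t - T))"])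
    show "{0..} = {0..T} \<union> {T..}" using * by simp
    show "t \<in> {0..T} \<union> {T..}" using * t by simp
    show "(\<phi> has_vector_derivative h (\<phi> t)) (at t within {0..T} \<union> closure {0..T} \<inter> closure {T..})"
      if "t \<in> {0..T} \<union> closure {0..T} \<inter> closure {T..}"
      using that \<phi>[of t] T by (auto simp: insert_absorb)
    show "((\<lambda>t. \<psi> (t - T)) has_vector_derivative h (\<psi> (t - T))) (at t within {T..} \<union> closure {0..T} \<inter> closure {T..})"
      if "t \<in> {T..} \<union> closure {0..T} \<inter> closure {T..}"
    proof -
      have tT: "T \<le> t" using that by auto
      have "(\<psi> has_vector_derivative h (\<psi> (t - T))) (at (t - T) within {0..})"
        using \<psi> tT unfolding forward_solution_def by simp
      then have "(\<psi> has_vector_derivative h (\<psi> (t - T))) (at (t - T) within (\<lambda>t. t - T) ` {T..})"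
        by (rule has_vector_derivative_within_subset) auto
      moreover have "((\<lambda>t. t - T) has_vector_derivative 1) (at t within {T..})"
        by (auto intro!: derivative_eq_intros)
      ultimately have "((\<lambda>t. \<psi> (t - T)) has_vector_derivative h (\<psi> (t - T))) (at t within {T..})"
        using vector_diff_chain_within[of "\<lambda>t. t - T" 1 t "{T..}" \<psi> "h (\<psi> (t - T))"] by (simp add: o_def)
      moreover have "{T..} \<union> closure {0..T} \<inter> closure {T..} = {T..}" by auto
      ultimately show ?thesis by simp
    qed
    show "\<phi> t = \<psi> (t - T)" if "t \<in> closure {0..T}" "t \<in> closure {T..}"
      using that \<psi>0 by (auto simp: order_antisym)
    show "h (\<phi> t) = h (\<psi> (t - T))" if "t \<in> closure {0..T}" "t \<in> closure {T..}"
      using that \<psi>0 by (auto simp: order_antisym)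
  qed
  then have "(?\<chi> has_vector_derivative h (if t \<le> T then \<phi> t else \<psi> (t - T))) (at t within {0..})"
    using t by (simp split: if_splits)
  then show "((\<lambda>t. if t \<le> T then \<phi> t else \<psi> (t - T)) has_vector_derivative
      h (if t \<le> T then \<phi> t else \<psi> (t - T))) (at t within {0..})"
    by (rule has_vector_derivative_transform[rotated 2]) (use t in auto)
qed

text \<open>Gronwall in both directions of time: the squared distance \<open>q\<close> satisfies
  \<open>\<bar>q'\<bar> \<le> 2 L q\<close>, so \<open>exp (- 2 L t) q\<close> is nonincreasing and
  \<open>exp (2 L t) q\<close> is nondecreasing. The second fact bounds the initial distance by the
  final one; it is what makes preimages of null sets null.\<close>

lemma ode_solutions_dist_le:
  fixes u v :: "real \<Rightarrow> 'a::euclidean_space"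
  assumes L: "L-lipschitz_on X h" and T: "0 \<le> T"
    and u: "\<And>t. t \<in> {0..T} \<Longrightarrow> (u has_vector_derivative h (u t)) (at t within {0..T})"
    and v: "\<And>t. t \<in> {0..T} \<Longrightarrow> (v has_vector_derivative h (v t)) (at t within {0..T})"
    and uX: "\<And>t. t \<in> {0..T} \<Longrightarrow> u t \<in> X" and vX: "\<And>t. t \<in> {0..T} \<Longrightarrow> v t \<in> X"
  shows "norm (u T - v T) \<le> exp (L * T) * norm (u 0 - v 0)"
    and "norm (u 0 - v 0) \<le> exp (L * T) * norm (u T - v T)"
proof -
  define q where "q t = (u t - v t) \<bullet> (u t - v t)" for t
  define q' where "q' t = 2 * ((u t - v t) \<bullet> (h (u t) - h (v t)))" for t
  have q: "(q has_real_derivative q' t) (at t within {0..T})" if "t \<in> {0..T}" for t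
    unfolding has_real_derivative_iff_has_vector_derivative q_def q'_def
    using u[OF that] v[OF that]
    unfolding has_vector_derivative_def
    by (auto intro!: derivative_eq_intros simp: algebra_simps inner_commute)
  have q': "\<bar>q' t\<bar> \<le> 2 * L * q t" if "t \<in> {0..T}" for t
  proof -
    have "\<bar>q' t\<bar> \<le> 2 * (norm (u t - v t) * norm (h (u t) - h (v t)))"
      unfolding q'_def by (simp add: abs_mult Cauchy_Schwarz_ineq2)
    also have "\<dots> \<le> 2 * (norm (u t - v t) * (L * norm (u t - v t)))"
      using lipschitz_on_normD[OF L uX vX, OF that that] by (intro mult_left_mono) auto
    finally show ?thesis
      by (simp add: q_def power2_norm_eq_inner[symmetric] power2_eq_square ac_simps)
  qed
  have qn: "sqrt (q t) = norm (u t - v t)" for t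
    by (simp add: q_def norm_eq_sqrt_inner)
  define p where "p c t = exp (c * t) * q t" for c t :: real
  have p: "(p c has_real_derivative (exp (c * t) * (c * q t + q' t))) (at t within {0..T})"
    if "t \<in> {0..T}" for t c
    unfolding p_def using q[OF that] by (auto intro!: derivative_eq_intros simp: algebra_simps)
  have cont: "continuous_on {0..T} (p c)" for c
    by (rule DERIV_continuous_on) (rule p)
  have p_int: "(p c has_real_derivative (exp (c * t) * (c * q t + q' t))) (at t)"
    if "0 < t" "t < T" for t c
    using p[of t c] that at_within_Icc_at[of 0 t T] by simp
  have "p (- (2 * L)) T \<le> p (- (2 * L)) 0"
  proof (rule DERIV_nonpos_imp_decreasing_open[OF T _ cont])
    fix t assume "0 < t" "t < T"
    note t = this
    show "\<exists>d. (p (- (2 * L)) has_real_derivative d) (at t) \<and> d \<le> 0"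
    proof (intro exI conjI)
      show "(p (- (2 * L)) has_real_derivative exp ((- (2 * L)) * t) * ((- (2 * L)) * q t + q' t)) (at t)"
        by (rule p_int[OF t])
      show "exp ((- (2 * L)) * t) * ((- (2 * L)) * q t + q' t) \<le> 0"
        using q'[of t] t by (intro mult_nonneg_nonpos) auto
    qed
  qed
  then have "q T \<le> exp (2 * L * T) * q 0"
    by (simp add: p_def exp_minus field_simps)
  then have "sqrt (q T) \<le> sqrt (exp (L * T) * exp (L * T) * q 0)"
    by (simp add: exp_add[symmetric] algebra_simps)
  then show "norm (u T - v T) \<le> exp (L * T) * norm (u 0 - v 0)"
    by (simp add: real_sqrt_mult qn)
  have "p (2 * L) 0 \<le> p (2 * L) T"
  proof (rule DERIV_nonneg_imp_increasing_open[OF T _ cont])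
    fix t assume "0 < t" "t < T"
    note t = this
    show "\<exists>d. (p (2 * L) has_real_derivative d) (at t) \<and> 0 \<le> d"
    proof (intro exI conjI)
      show "(p (2 * L) has_real_derivative exp (2 * L * t) * (2 * L * q t + q' t)) (at t)"
        by (rule p_int[OF t])
      show "0 \<le> exp (2 * L * t) * (2 * L * q t + q' t)"
        using q'[of t] t by (intro mult_nonneg_nonneg) auto
    qed
  qed
  then have "q 0 \<le> exp (2 * L * T) * q T"
    by (simp add: p_def)
  then have "sqrt (q 0) \<le> sqrt (exp (L * T) * exp (L * T) * q T)"
    by (simp add: exp_add[symmetric] algebra_simps)
  then show "norm (u 0 - v 0) \<le> exp (L * T) * norm (u T - v T)"
    by (simp add: real_sqrt_mult qn)
qed

section \<open>Global existence of forward solutions\<close>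

lemma integral_has_vector_derivative_atLeast:
  fixes g :: "real \<Rightarrow> 'a::banach"
  assumes "continuous_on {0..} g" "0 \<le> t"
  shows "((\<lambda>u. integral {0..u} g) has_vector_derivative g t) (at t within {0..})"
proof -
  have "((\<lambda>u. integral {0..u} g) has_vector_derivative g t) (at t within {0..t + 1})"
    using assms by (intro integral_has_vector_derivative) (auto intro: continuous_on_subset)
  moreover have "at t within {0..t + 1} = at t within {0..}"
    by (rule at_within_nhd[of t "{..<t + 1}"]) auto
  ultimately show ?thesis by simp
qed

text \<open>Picard iteration for the unknown \<open>w\<close> with \<open>\<phi> t = y + exp (2 K t) w t\<close>: the exponential
  weight makes the integral operator a contraction on the whole half line at once.\<close>

lemma forward_solution_exists_lipschitz:
  fixes h :: "'a::euclidean_space \<Rightarrow> 'a"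
  assumes "L-lipschitz_on UNIV h" and bdd: "bounded (range h)"
  shows "\<exists>\<phi>. forward_solution h y \<phi>"
proof -
  \<comment> \<open>\<open>L\<close> may be \<open>0\<close>, but the bound
    \<open>B / (2 * K)\<close> below needs a positive constant.\<close>
  define K where "K = L + 1"
  have K: "0 < K"
    using lipschitz_on_nonneg[OF assms(1)] by (simp add: K_def)
  have lip: "K-lipschitz_on UNIV h"
    by (rule lipschitz_on_mono[OF assms(1)]) (simp_all add: K_def)
  have h_cont: "continuous_on UNIV h"
    by (rule lipschitz_on_continuous_on[OF lip])
  obtain B where B: "norm (h x) \<le> B" for x
    using bdd unfolding bounded_iff by blast
  have B0: "0 \<le> B" using B[of 0] norm_ge_zero[of "h 0"] by linarith
  define G where "G w s = h (y + exp (2 * K * s) *\<^sub>R w s)" for w :: "real \<Rightarrow> 'a" and s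
  define J where "J w t = integral {0..t} (G w)" for w t
  \<comment> \<open>Bounded continuous functions live on the whole line, so negative times are moved
    to \<open>0\<close>, where the integral vanishes. For \<open>t \<ge> 0\<close> a fixed point
    satisfies \<open>exp (2 K t) w t = J w t\<close>, the integral equation for the
    solution.\<close>
  define P where "P w t = exp (- (2 * K * max t 0)) *\<^sub>R J w (max t 0)" for w t
  have G_cont: "continuous_on S (G w)" if "continuous_on UNIV w" for w S
    unfolding G_def
    by (rule continuous_on_compose2[OF h_cont])
      (auto intro!: continuous_intros intro: continuous_on_subset[OF that])
  have G_int: "G w integrable_on {0..t}" if "continuous_on UNIV w" for w t
    by (rule integrable_continuous_real[OF G_cont[OF that]])
  have J_deriv: "(J w has_vector_derivative G w t) (at t within {0..})"
    if "continuous_on UNIV w" "0 \<le> t" for w t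
    unfolding J_def by (rule integral_has_vector_derivative_atLeast[OF G_cont[OF that(1)] that(2)])
  have J_cont: "continuous_on {0..} (J w)" if "continuous_on UNIV w" for w
    using J_deriv[OF that]
    by (auto simp: continuous_on_eq_continuous_within intro!: has_vector_derivative_continuous)
  have P_cont: "continuous_on UNIV (P w)" if "continuous_on UNIV w" for w
    unfolding P_def
    by (intro continuous_intros continuous_on_compose2[OF J_cont[OF that]]) auto
  have P_bdd: "norm (P w t) \<le> B / (2 * K)" if "continuous_on UNIV w" for w t
  proof -
    define s where "s = max t 0"
    have s: "0 \<le> s" by (simp add: s_def)
    \<comment> \<open>Used with \<open>x = 2 * K * s\<close>: the unweighted integral grows at most
      like \<open>B * s\<close>, and the exponential weight keeps that bounded.\<close>
    have x_exp: "x * exp (- x) \<le> 1" for x :: real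
    proof -
      have "x * exp (- x) \<le> exp x * exp (- x)"
        by (rule mult_right_mono[OF order_trans[OF _ exp_ge_add_one_self]]) auto
      then show ?thesis by (simp add: exp_minus)
    qed
    have "norm (J w s) \<le> B * (s - 0)"
      unfolding J_def using G_cont[OF that] s B by (intro integral_bound) (auto simp: G_def)
    then have "norm (P w t) \<le> exp (- (2 * K * s)) * (B * s)"
      by (simp add: P_def s_def[symmetric])
    also have "\<dots> = (B / (2 * K)) * ((2 * K * s) * exp (- (2 * K * s)))"
      using K by simp
    also have "\<dots> \<le> (B / (2 * K)) * 1"
      using K B0 by (intro mult_left_mono x_exp) auto
    finally show ?thesis by simp
  qed
  have P_in: "P (apply_bcontfun w) \<in> bcontfun" for w :: "real \<Rightarrow>\<^sub>C 'a"
    unfolding bcontfun_def bounded_iff using P_cont[of w] P_bdd[of w] by blast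
  define \<Phi> where "\<Phi> w = Bcontfun (P (apply_bcontfun w))" for w :: "real \<Rightarrow>\<^sub>C 'a"
  have \<Phi>: "apply_bcontfun (\<Phi> w) = P (apply_bcontfun w)" for w
    unfolding \<Phi>_def by (rule Bcontfun_inverse[OF P_in])
  have contr: "dist (\<Phi> w) (\<Phi> w') \<le> 1 / 2 * dist w w'" for w w'
  proof (rule dist_bound)
    fix t :: real
    define s where "s = max t 0"
    define d where "d = dist w w'"
    have s: "0 \<le> s" by (simp add: s_def)
    \<comment> \<open>The Lipschitz bound of the integrand is exactly the derivative of
      \<open>exp (2 K u) d / 2\<close>; removing the weight again leaves the contraction factor
      \<open>1 / 2\<close>.\<close>
    have int: "((\<lambda>u. K * exp (2 * K * u) * d) has_integral (exp (2 * K * s) * d / 2 - exp (2 * K * 0) * d / 2)) {0..s}"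
      using K by (intro fundamental_theorem_of_calculus s)
        (auto intro!: derivative_eq_intros simp: has_real_derivative_iff_has_vector_derivative[symmetric])
    have "norm (J w s - J w' s) = norm (integral {0..s} (\<lambda>u. G w u - G w' u))"
      unfolding J_def by (subst integral_diff[OF G_int G_int]) auto
    also have "\<dots> \<le> integral {0..s} (\<lambda>u. K * exp (2 * K * u) * d)"
    proof (rule integral_norm_bound_integral)
      show "(\<lambda>u. G w u - G w' u) integrable_on {0..s}"
        by (intro integrable_diff G_int) auto
      show "(\<lambda>u. K * exp (2 * K * u) * d) integrable_on {0..s}"
        using int by blast
      fix u
      have "norm (G w u - G w' u) \<le> K * norm (exp (2 * K * u) *\<^sub>R w u - exp (2 * K * u) *\<^sub>R w' u)"
        unfolding G_def using lipschitz_on_normD[OF lip, of "y + exp (2 * K * u) *\<^sub>R w u" "y + exp (2 * K * u) *\<^sub>R w' u"] by simp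
      also have "norm (exp (2 * K * u) *\<^sub>R w u - exp (2 * K * u) *\<^sub>R w' u) = exp (2 * K * u) * dist (w u) (w' u)"
        by (simp add: dist_norm scaleR_diff_right[symmetric])
      also have "dist (w u) (w' u) \<le> d"
        unfolding d_def by (rule dist_bounded)
      finally show "norm (G w u - G w' u) \<le> K * exp (2 * K * u) * d"
        using K by (simp add: mult_left_mono)
    qed
    also have "\<dots> = exp (2 * K * s) * d / 2 - d / 2"
      using integral_unique[OF int] by simp
    also have "\<dots> \<le> exp (2 * K * s) * d / 2"
      by (simp add: d_def)
    finally have *: "norm (J w s - J w' s) \<le> exp (2 * K * s) * d / 2" .
    have "dist (P w t) (P w' t) = exp (- (2 * K * s)) * norm (J w s - J w' s)"
      by (simp add: P_def s_def[symmetric] dist_norm scaleR_diff_right[symmetric])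
    also have "\<dots> \<le> exp (- (2 * K * s)) * (exp (2 * K * s) * d / 2)"
      using * by (intro mult_left_mono) auto
    also have "\<dots> = d / 2"
      by (simp add: exp_minus)
    finally show "dist (\<Phi> w t) (\<Phi> w' t) \<le> 1 / 2 * dist w w'"
      by (simp add: \<Phi> d_def)
  qed
  obtain w where w: "\<Phi> w = w"
    using banach_fix_type[of "1/2" \<Phi>] contr by auto
  define \<phi> where "\<phi> t = y + J w t" for t
  have \<phi>: "\<phi> t = y + exp (2 * K * t) *\<^sub>R w t" if "0 \<le> t" for t
  proof -
    have "w t = P w t" using w \<Phi>[of w] by simp
    then show ?thesis
      using that by (simp add: \<phi>_def P_def exp_minus)
  qed
  have "forward_solution h y \<phi>"
    unfolding forward_solution_def
  proof (intro conjI allI impI)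
    show "\<phi> 0 = y" by (simp add: \<phi>_def J_def)
    fix t :: real assume t: "0 \<le> t"
    have "(\<phi> has_vector_derivative 0 + G w t) (at t within {0..})"
      unfolding \<phi>_def using J_deriv[of w t] t by (intro has_vector_derivative_add) auto
    then show "(\<phi> has_vector_derivative h (\<phi> t)) (at t within {0..})"
      by (simp add: G_def \<phi>[OF t])
  qed
  then show ?thesis by blast
qed

text \<open>Composing \<open>h\<close> with the projection onto the ball of radius \<open>r\<close>
  gives a bounded, globally Lipschitz field that agrees with \<open>h\<close> inside the ball. Its
  solution is a solution for \<open>h\<close> up to the first time at which the norm reaches
  \<open>r\<close>, and from there \<open>far\<close> supplies the continuation.\<close>

lemma forward_solution_exists_if_far:
  fixes h :: "'a::euclidean_space \<Rightarrow> 'a"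
  assumes lip: "\<And>r. \<exists>L. L-lipschitz_on (cball 0 r) h"
    and far: "\<And>y. r \<le> norm y \<Longrightarrow> \<exists>\<phi>. forward_solution h y \<phi>"
  shows "\<exists>\<phi>. forward_solution h y \<phi>"
proof (cases "r \<le> norm y")
  case False
  then have yr: "norm y < r" and r: "0 \<le> r"
    using norm_ge_zero[of y] by linarith+
  define C where "C = cball (0::'a) r"
  have C: "convex C" "closed C" "C \<noteq> {}" "compact C"
    using r by (auto simp: C_def)
  obtain L where L: "L-lipschitz_on C h"
    using lip C_def by auto
  have cp: "closest_point C x \<in> C" for x
    by (rule closest_point_in_set) (use C in auto)
  define k where "k x = h (closest_point C x)" for x
  have "L-lipschitz_on UNIV k"
  proof (rule lipschitz_onI)
    fix x x' :: 'a
    have "dist (k x) (k x') \<le> L * dist (closest_point C x) (closest_point C x')"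
      unfolding k_def by (rule lipschitz_onD[OF L cp cp])
    also have "\<dots> \<le> L * dist x x'"
      using lipschitz_on_nonneg[OF L] closest_point_lipschitz[OF C(1-3)] by (intro mult_left_mono)
    finally show "dist (k x) (k x') \<le> L * dist x x'" .
  qed (rule lipschitz_on_nonneg[OF L])
  moreover have "bounded (range k)"
  proof (rule bounded_subset)
    show "bounded (h ` C)"
      using C L by (intro compact_imp_bounded compact_continuous_image lipschitz_on_continuous_on)
  qed (use cp in \<open>auto simp: k_def\<close>)
  ultimately obtain \<phi> where \<phi>: "forward_solution k y \<phi>"
    using forward_solution_exists_lipschitz by blast
  have kh: "k x = h x" if "norm x \<le> r" for x
    using that by (simp add: k_def C_def closest_point_self)
  have \<phi>0: "\<phi> 0 = y" and \<phi>': "\<And>t. 0 \<le> t \<Longrightarrow> (\<phi> has_vector_derivative k (\<phi> t)) (at t within {0..})"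
    using \<phi> by (auto simp: forward_solution_def)
  note \<phi>_cont = forward_solution_continuous_on[OF \<phi>]
  show ?thesis
  proof (cases "\<forall>t\<ge>0. norm (\<phi> t) \<le> r")
    case True
    then have "forward_solution h y \<phi>"
      using \<phi>0 \<phi>' kh unfolding forward_solution_def by metis
    then show ?thesis by blast
  next
    case False
    \<comment> \<open>The non-strict inequality makes \<open>E\<close> closed, so its infimum
      belongs to it and \<open>far\<close> applies at that very time.\<close>
    define E where "E = {t \<in> {0..}. r \<le> norm (\<phi> t)}"
    have "E \<noteq> {}" using False by (force simp: E_def)
    moreover have "closed E"
      unfolding E_def using \<phi>_cont
      by (intro continuous_on_closed_Collect_le continuous_intros) auto
    moreover have bb: "bdd_below E" by (rule bdd_belowI[of _ 0]) (auto simp: E_def)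
    ultimately have "Inf E \<in> E" by (intro closed_contains_Inf)
    define T where "T = Inf E"
    have T: "0 \<le> T" "r \<le> norm (\<phi> T)"
      using \<open>Inf E \<in> E\<close> by (auto simp: T_def E_def)
    have Tpos: "0 < T"
      using T yr \<phi>0 by (cases "T = 0") auto
    have below: "norm (\<phi> t) \<le> r" if "t \<in> {0..<T}" for t
    proof (rule ccontr)
      assume "\<not> norm (\<phi> t) \<le> r"
      then have "t \<in> E" using that by (auto simp: E_def)
      then show False using cInf_lower[OF _ bb, of t] that by (auto simp: T_def)
    qed
    have le: "norm (\<phi> t) \<le> r" if "t \<in> {0..T}" for t
    proof (rule continuous_le_on_closure[of "{0..<T}" "\<lambda>t. norm (\<phi> t)"])
      show "continuous_on (closure {0..<T}) (\<lambda>t. norm (\<phi> t))"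
        using Tpos by (auto intro!: continuous_intros continuous_on_subset[OF \<phi>_cont])
    qed (use that Tpos below in auto)
    obtain \<psi> where \<psi>: "forward_solution h (\<phi> T) \<psi>"
      using far T by blast
    have "(\<phi> has_vector_derivative h (\<phi> t)) (at t within {0..T})" if "t \<in> {0..T}" for t
    proof (rule has_vector_derivative_within_subset)
      show "(\<phi> has_vector_derivative h (\<phi> t)) (at t within {0..})"
        using \<phi>'[of t] kh[OF le[OF that]] that by auto
    qed auto
    from forward_solution_splice[OF T(1) \<phi>0 this \<psi>] show ?thesis by blast
  qed
qed (rule far)

section \<open>Uniqueness, trapped sets and preimages of null sets\<close>

lemma forward_solutions_dist_le:
  fixes h :: "'a::euclidean_space \<Rightarrow> 'a"
  assumes "L-lipschitz_on X h" "forward_solution h y \<phi>" "forward_solution h z \<psi>" "0 \<le> T"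
    and "\<And>t. t \<in> {0..T} \<Longrightarrow> \<phi> t \<in> X" "\<And>t. t \<in> {0..T} \<Longrightarrow> \<psi> t \<in> X"
  shows "norm (\<phi> T - \<psi> T) \<le> exp (L * T) * norm (y - z)"
    and "norm (y - z) \<le> exp (L * T) * norm (\<phi> T - \<psi> T)"
proof -
  have "(\<phi> has_vector_derivative h (\<phi> t)) (at t within {0..T})"
    "(\<psi> has_vector_derivative h (\<psi> t)) (at t within {0..T})" if "t \<in> {0..T}" for t
    using assms(2,3) that by (auto simp: forward_solution_def intro: has_vector_derivative_within_subset)
  from ode_solutions_dist_le[OF assms(1,4) this assms(5,6)]
  show "norm (\<phi> T - \<psi> T) \<le> exp (L * T) * norm (y - z)"
    and "norm (y - z) \<le> exp (L * T) * norm (\<phi> T - \<psi> T)"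
    using assms(2,3) by (simp_all add: forward_solution_def)
qed

lemma forward_solution_bounded_on:
  fixes h :: "'a::euclidean_space \<Rightarrow> 'a"
  assumes "forward_solution h y \<phi>"
  obtains r where "\<And>t. t \<in> {0..T} \<Longrightarrow> norm (\<phi> t) \<le> r"
proof -
  have "compact (\<phi> ` {0..T})"
    using forward_solution_continuous_on[OF assms]
    by (intro compact_continuous_image) (auto intro: continuous_on_subset)
  then show ?thesis
    using that compact_imp_bounded[of "\<phi> ` {0..T}"] by (force simp: bounded_iff)
qed

lemma forward_solution_unique:
  fixes h :: "'a::euclidean_space \<Rightarrow> 'a"
  assumes lip: "\<And>r. \<exists>L. L-lipschitz_on (cball 0 r) h"
    and \<phi>: "forward_solution h y \<phi>" and \<psi>: "forward_solution h y \<psi>" and T: "0 \<le> T"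
  shows "\<phi> T = \<psi> T"
proof -
  obtain r where r: "\<And>t. t \<in> {0..T} \<Longrightarrow> norm (\<phi> t) \<le> r"
    using forward_solution_bounded_on[OF \<phi>] by blast
  obtain s where s: "\<And>t. t \<in> {0..T} \<Longrightarrow> norm (\<psi> t) \<le> s"
    using forward_solution_bounded_on[OF \<psi>] by blast
  obtain L where "L-lipschitz_on (cball 0 (max r s)) h"
    using lip by blast
  from forward_solutions_dist_le(1)[OF this \<phi> \<psi> T] show ?thesis
    using r s by (auto simp: le_max_iff_disj)
qed

text \<open>Closedness is continuous dependence at each fixed time \<open>T\<close>: the
  approximating solutions stay in \<open>K\<close> and the limit solution is bounded on
  \<open>{0..T}\<close>, so one Lipschitz constant serves all of them, and \<open>K\<close> is
  closed.\<close>

lemma compact_forward_trapped: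
  fixes h :: "'a::euclidean_space \<Rightarrow> 'a"
  assumes lip: "\<And>r. \<exists>L. L-lipschitz_on (cball 0 r) h"
    and ex: "\<And>y. \<exists>\<phi>. forward_solution h y \<phi>" and K: "compact K"
  shows "compact {y. \<exists>\<phi>. forward_solution h y \<phi> \<and> (\<forall>t\<ge>0. \<phi> t \<in> K)}" (is "compact ?S")
proof -
  have "?S \<subseteq> K"
    unfolding forward_solution_def by force
  moreover have "closed ?S"
    unfolding closed_sequential_limits
  proof (intro allI impI, elim conjE)
    fix Y y assume Y: "\<forall>n. Y n \<in> ?S" and lim: "Y \<longlonglongrightarrow> y"
    from Y obtain \<Psi> where \<Psi>: "\<And>n. forward_solution h (Y n) (\<Psi> n)" "\<And>n t. 0 \<le> t \<Longrightarrow> \<Psi> n t \<in> K"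
      by simp metis
    obtain \<phi> where \<phi>: "forward_solution h y \<phi>" using ex by blast
    have "\<phi> T \<in> K" if T: "0 \<le> T" for T
    proof -
      obtain r where r: "\<And>t. t \<in> {0..T} \<Longrightarrow> norm (\<phi> t) \<le> r"
        using forward_solution_bounded_on[OF \<phi>] by blast
      obtain s where s: "\<And>x. x \<in> K \<Longrightarrow> norm x \<le> s"
        using compact_imp_bounded[OF K] by (auto simp: bounded_iff)
      obtain L where L: "L-lipschitz_on (cball 0 (max r s)) h"
        using lip by blast
      have "norm (\<Psi> n T - \<phi> T) \<le> exp (L * T) * norm (Y n - y)" for n
        using r s \<Psi>(2) by (intro forward_solutions_dist_le(1)[OF L \<Psi>(1) \<phi> T]) (auto simp: le_max_iff_disj)
      moreover have "(\<lambda>n. exp (L * T) * norm (Y n - y)) \<longlonglongrightarrow> 0"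
        using lim by (intro tendsto_mult_right_zero tendsto_norm_zero) (simp add: LIM_zero_iff)
      ultimately have "(\<lambda>n. \<Psi> n T - \<phi> T) \<longlonglongrightarrow> 0"
        by (rule Lim_null_comparison[OF always_eventually[OF allI]])
      then have "(\<lambda>n. \<Psi> n T) \<longlonglongrightarrow> \<phi> T"
        by (simp add: LIM_zero_iff)
      with compact_imp_closed[OF K] \<Psi>(2)[OF T] show ?thesis
        by (rule closed_sequentially)
    qed
    with \<phi> show "y \<in> ?S" by blast
  qed
  ultimately show ?thesis
    using compact_Int_closed[OF K, of ?S] by (simp only: Int_absorb1)
qed

text \<open>Following solutions backwards in time is a Lipschitz operation on bounded sets.\<close>

lemma negligible_forward_preimage:
  fixes h :: "'a::euclidean_space \<Rightarrow> 'a"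
  assumes lip: "L-lipschitz_on (cball 0 r) h" and S: "negligible S" and T: "0 \<le> T"
  shows "negligible {y. \<exists>\<phi>. forward_solution h y \<phi> \<and> (\<forall>t\<in>{0..T}. norm (\<phi> t) \<le> r) \<and> \<phi> T \<in> S}"
    (is "negligible ?A")
proof -
  let ?P = "\<lambda>y \<phi>. forward_solution h y \<phi> \<and> (\<forall>t\<in>{0..T}. norm (\<phi> t) \<le> r) \<and> \<phi> T \<in> S"
  have "\<forall>y\<in>?A. \<exists>\<phi>. ?P y \<phi>" by blast
  from bchoice[OF this] obtain \<Phi> where \<Phi>': "\<forall>y\<in>?A. ?P y (\<Phi> y)" by blast
  have \<Phi>: "forward_solution h y (\<Phi> y)" "\<Phi> y T \<in> S" "\<forall>t\<in>{0..T}. \<Phi> y t \<in> cball 0 r" if "y \<in> ?A" for y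
    using \<Phi>' that by auto
  define E where "E y = \<Phi> y T" for y
  have E: "norm (y - z) \<le> exp (L * T) * norm (E y - E z)" if "y \<in> ?A" "z \<in> ?A" for y z
    unfolding E_def
    by (rule forward_solutions_dist_le(2)[OF lip \<Phi>(1)[OF that(1)] \<Phi>(1)[OF that(2)] T])
      (use \<Phi>(3) that in blast)+
  have inj: "inj_on E ?A"
  proof (rule inj_onI)
    fix y z assume "y \<in> ?A" "z \<in> ?A" "E y = E z"
    with E[of y z] show "y = z" by simp
  qed
  \<comment> \<open>Writes \<open>?A\<close> as the image of a subset of \<open>S\<close> under the
    inverse of the end-point map \<open>E\<close>; by the backward Gronwall estimate that inverse is
    Lipschitz and so preserves null sets.\<close>
  have eq: "inv_into ?A E ` (E ` ?A) = ?A"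
    using inj by (rule inv_into_image_cancel) (rule subset_refl)
  have "negligible (inv_into ?A E ` (E ` ?A))"
  proof (rule negligible_locally_Lipschitz_image)
    show "negligible (E ` ?A)"
      by (rule negligible_subset[OF S]) (use \<Phi>(2) E_def in force)
    fix x assume x: "x \<in> E ` ?A"
    have "norm (inv_into ?A E y - inv_into ?A E x) \<le> exp (L * T) * norm (y - x)" if y: "y \<in> E ` ?A" for y
      using E[OF inv_into_into[OF y] inv_into_into[OF x]]
      by (simp only: f_inv_into_f[OF x] f_inv_into_f[OF y])
    then show "\<exists>U B. open U \<and> x \<in> U \<and> (\<forall>y\<in>E ` ?A \<inter> U. norm (inv_into ?A E y - inv_into ?A E x) \<le> B * norm (y - x))"
      by (intro exI[of _ UNIV] exI[of _ "exp (L * T)"]) blast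
  qed simp
  then show ?thesis
    by (simp only: eq)
qed

section \<open>Integration by parts and mollification\<close>

lemma integrable_compact_support:
  fixes f :: "'a::euclidean_space \<Rightarrow> real"
  assumes "continuous_on UNIV f" "compact C" "\<And>x. x \<notin> C \<Longrightarrow> f x = 0"
  shows "integrable lborel f"
proof -
  have "integrable lborel (\<lambda>x. indicator C x *\<^sub>R f x)"
    using assms by (intro borel_integrable_compact) (auto intro: continuous_on_subset)
  also have "(\<lambda>x. indicator C x *\<^sub>R f x) = f"
    using assms(3) by (fastforce simp: indicator_def)
  finally show ?thesis .
qed

lemma lborel_integral_translation:
  fixes f :: "'a::euclidean_space \<Rightarrow> real"
  assumes "f \<in> borel_measurable borel"
  shows "(\<integral>x. f (y + x) \<partial>lborel) = (\<integral>x. f x \<partial>lborel)"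
  using integral_distr[of "(+) y" lborel borel f] assms by (simp add: lborel_distr_plus)

lemma continuous_compact_support_bounded:
  fixes f :: "'a::euclidean_space \<Rightarrow> real"
  assumes "continuous_on UNIV f" "compact C" "\<And>x. x \<notin> C \<Longrightarrow> f x = 0"
  obtains B where "0 \<le> B" "\<And>x. \<bar>f x\<bar> \<le> B"
proof -
  have "compact (f ` C)"
    using assms by (intro compact_continuous_image) (auto intro: continuous_on_subset)
  then obtain B where "\<And>x. x \<in> C \<Longrightarrow> \<bar>f x\<bar> \<le> B"
    using compact_imp_bounded by (force simp: bounded_iff)
  then have "\<bar>f x\<bar> \<le> max B 0" for x
    using assms(3)[of x] by (cases "x \<in> C") (auto simp: le_max_iff_disj)
  then show ?thesis using that[of "max B 0"] by simp
qed

lemma has_derivative_zero_outside_support: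
  fixes f :: "'a::real_normed_vector \<Rightarrow> 'b::real_normed_vector"
  assumes "(f has_derivative f') (at y)" "closed C" "\<And>x. x \<notin> C \<Longrightarrow> f x = 0" "y \<notin> C"
  shows "f' = (\<lambda>_. 0)"
proof -
  have "(f has_derivative (\<lambda>_. 0)) (at y)"
    by (rule has_derivative_transform_within_open[of "\<lambda>_. 0" _ _ _ "- C"]) (use assms in auto)
  then show ?thesis using assms(1) has_derivative_unique by blast
qed

text \<open>Translation invariance makes every difference quotient of \<open>u\<close> in direction
  \<open>b\<close> integrate to \<open>0\<close>. The quotients converge to the derivative, and the
  mean value theorem dominates them by a constant on a fixed ball.\<close>

lemma integral_directional_derivative_eq_0:
  fixes u :: "'a::euclidean_space \<Rightarrow> real"
  assumes u: "\<And>y. (u has_derivative u' y) (at y)" and cont: "continuous_on UNIV (\<lambda>y. u' y b)"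
    and C: "compact C" and supp: "\<And>y. y \<notin> C \<Longrightarrow> u y = 0"
  shows "integrable lborel (\<lambda>y. u' y b)" "(\<integral>y. u' y b \<partial>lborel) = 0"
proof -
  have supp': "u' y b = 0" if "y \<notin> C" for y
    using has_derivative_zero_outside_support[OF u compact_imp_closed[OF C] supp that] by simp
  show int': "integrable lborel (\<lambda>y. u' y b)"
    by (rule integrable_compact_support[OF cont C supp'])
  have u_cont: "continuous_on UNIV u"
    using has_derivative_continuous[OF u] by (simp add: continuous_on_eq_continuous_within)
  have [measurable]: "u \<in> borel_measurable borel"
    by (rule borel_measurable_continuous_onI[OF u_cont])
  have int: "integrable lborel u"
    by (rule integrable_compact_support[OF u_cont C supp])
  obtain B where B: "0 \<le> B" "\<And>y. \<bar>u' y b\<bar> \<le> B"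
    using continuous_compact_support_bounded[OF cont C supp'] by blast
  obtain R where R: "\<And>y. y \<in> C \<Longrightarrow> norm y \<le> R"
    using compact_imp_bounded[OF C] by (auto simp: bounded_iff)
  define t where "t n = 1 / real (Suc n)" for n
  have t: "0 < t n" "t n \<le> 1" for n
    by (auto simp: t_def divide_simps)
  have t0: "t \<longlonglongrightarrow> 0"
    unfolding t_def by (rule lim_1_over_n[THEN LIMSEQ_Suc])
  define q where "q n y = (u (t n *\<^sub>R b + y) - u y) / t n" for n y
  have line: "((\<lambda>s. u (s *\<^sub>R b + y)) has_real_derivative u' (s *\<^sub>R b + y) b) (at s)" for s y
  proof -
    have "((\<lambda>s. u (s *\<^sub>R b + y)) has_derivative (\<lambda>h. u' (s *\<^sub>R b + y) (h *\<^sub>R b))) (at s)"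
      by (rule has_derivative_compose[OF _ u, where f = "\<lambda>s. s *\<^sub>R b + y"])
        (auto intro!: derivative_eq_intros)
    moreover have "u' (s *\<^sub>R b + y) (h *\<^sub>R b) = u' (s *\<^sub>R b + y) b * h" for h
      using linear_scale[OF has_derivative_linear[OF u]] by (simp add: mult.commute)
    ultimately show ?thesis
      by (simp add: has_field_derivative_def)
  qed
  have q_bound: "\<bar>q n y\<bar> \<le> B" for n y
  proof -
    obtain z where "u (t n *\<^sub>R b + y) - u (0 *\<^sub>R b + y) = (t n - 0) * u' (z *\<^sub>R b + y) b"
      using MVT2[OF t(1)[of n], of "\<lambda>s. u (s *\<^sub>R b + y)" "\<lambda>s. u' (s *\<^sub>R b + y) b"] line by blast
    then have "q n y = u' (z *\<^sub>R b + y) b"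
      using t(1)[of n] by (simp add: q_def)
    then show ?thesis using B(2) by simp
  qed
  \<comment> \<open>Steps \<open>t n \<le> 1\<close> move the support by at most
    \<open>norm b\<close>, so one ball of radius \<open>R + norm b\<close> contains the supports of
    all quotients.\<close>
  have q_supp: "q n y = 0" if "R + norm b < norm y" for n y
  proof -
    have "norm (t n *\<^sub>R b) \<le> 1 * norm b"
      using t[of n] by (simp add: mult_left_le_one_le)
    moreover have "norm y \<le> norm (t n *\<^sub>R b + y) + norm (t n *\<^sub>R b)"
      using norm_triangle_ineq4[of "t n *\<^sub>R b + y" "t n *\<^sub>R b"] by simp
    ultimately have "R < norm (t n *\<^sub>R b + y)" using that by simp
    moreover have "R < norm y" using that norm_ge_zero[of b] by linarith
    ultimately have "t n *\<^sub>R b + y \<notin> C" "y \<notin> C"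
      using R by (auto dest: leD)
    then show ?thesis using supp by (simp add: q_def)
  qed
  have "(\<lambda>n. \<integral>y. q n y \<partial>lborel) \<longlonglongrightarrow> (\<integral>y. u' y b \<partial>lborel)"
  proof (rule integral_dominated_convergence)
    show "integrable lborel (\<lambda>y. indicator (cball 0 (R + norm b)) y *\<^sub>R B)"
      by (intro borel_integrable_compact) auto
    show "AE y in lborel. norm (q n y) \<le> indicator (cball 0 (R + norm b)) y *\<^sub>R B" for n
      using q_bound q_supp by (auto simp: indicator_def)
    show "AE y in lborel. (\<lambda>n. q n y) \<longlonglongrightarrow> u' y b"
    proof (rule AE_I2)
      fix y
      have "((\<lambda>h. (u ((0 + h) *\<^sub>R b + y) - u (0 *\<^sub>R b + y)) / h) \<longlongrightarrow> u' (0 *\<^sub>R b + y) b) (at 0)"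
        using line[of y 0] by (simp only: DERIV_def)
      then show "(\<lambda>n. q n y) \<longlonglongrightarrow> u' y b"
        unfolding q_def
        using t t0 by (auto simp: tendsto_at_iff_sequentially o_def less_imp_neq[symmetric])
    qed
    show "(\<lambda>y. u' y b) \<in> borel_measurable lborel" using int' by measurable
    show "q n \<in> borel_measurable lborel" for n
      unfolding q_def by measurable
  qed
  moreover have "(\<integral>y. q n y \<partial>lborel) = 0" for n
  proof -
    have "integrable lborel (\<lambda>y. u (t n *\<^sub>R b + y))"
      using integrable_distr_eq[of "(+) (t n *\<^sub>R b)" lborel borel u] int by (simp add: lborel_distr_plus)
    then show ?thesis
      unfolding q_def using int lborel_integral_translation[of u "t n *\<^sub>R b"] by simp
  qed
  ultimately show "(\<integral>y. u' y b \<partial>lborel) = 0"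
    by (simp add: LIMSEQ_const_iff)
qed

lemma divergence_at_eq:
  assumes "(G has_derivative G') (at y)"
  shows "divergence_at G y = (\<Sum>b\<in>Basis. G' b \<bullet> b)"
  using frechet_derivative_at[OF assms] by (simp add: divergence_at_def)

lemma C1_on_continuous_on_divergence:
  assumes "C1_on S G"
  shows "continuous_on S (divergence_at G)"
proof -
  obtain G' where G': "\<And>y. y \<in> S \<Longrightarrow> (G has_derivative blinfun_apply (G' y)) (at y)" "continuous_on S G'"
    using assms unfolding C1_on_def by blast
  have "continuous_on S (\<lambda>y. \<Sum>b\<in>Basis. G' y b \<bullet> b)"
    using G'(2) by (intro continuous_intros)
  then show ?thesis
    by (rule continuous_on_eq) (simp add: divergence_at_eq[OF G'(1)])
qed

text \<open>Sums the previous lemma over the functions \<open>\<Psi> (G \<bullet> b)\<close>. As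
  \<open>G\<close> is controlled only on \<open>S\<close>, every integrand is extended by zero from
  the compact support of \<open>\<Psi>\<close>.\<close>

lemma integral_divergence_by_parts:
  fixes G :: "'a::euclidean_space \<Rightarrow> 'a" and \<Psi> :: "'a \<Rightarrow> real"
  assumes \<Psi>: "\<And>y. (\<Psi> has_derivative blinfun_apply (\<Psi>' y)) (at y)" "continuous_on UNIV \<Psi>'"
    and S: "open S" and G: "C1_on S G" and N: "compact N" "N \<subseteq> S" and supp: "\<And>y. y \<notin> N \<Longrightarrow> \<Psi> y = 0"
  shows "integrable lborel (\<lambda>y. \<Psi> y * divergence_at G y)" "integrable lborel (\<lambda>y. \<Psi>' y (G y))"
    and "(\<integral>y. \<Psi> y * divergence_at G y \<partial>lborel) = - (\<integral>y. \<Psi>' y (G y) \<partial>lborel)"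
proof -
  have \<Psi>_cont: "continuous_on UNIV \<Psi>"
    using has_derivative_continuous[OF \<Psi>(1)] by (simp add: continuous_on_eq_continuous_within)
  have N_cl: "closed N" using N compact_imp_closed by blast
  have supp': "\<Psi>' y v = 0" if "y \<notin> N" for y v
    using has_derivative_zero_outside_support[OF \<Psi>(1) N_cl supp that] by simp
  \<comment> \<open>Gluing: \<open>S\<close> and \<open>- N\<close> are open and cover the space,
    and \<open>f\<close> vanishes on the second set.\<close>
  have *: "continuous_on UNIV f"
    if "continuous_on S f" "\<And>y. y \<notin> N \<Longrightarrow> f y = 0" for f :: "'a \<Rightarrow> real"
  proof -
    have "continuous_on (S \<union> - N) f"
    proof (rule continuous_on_open_Un)
      show "continuous_on (- N) f"
        using continuous_on_cong[of "- N" "- N" f "\<lambda>_. 0"] that(2) by simp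
    qed (use that S N_cl in auto)
    moreover have "S \<union> - N = UNIV" using N by auto
    ultimately show ?thesis by simp
  qed
  obtain G' where G': "\<And>y. y \<in> S \<Longrightarrow> (G has_derivative blinfun_apply (G' y)) (at y)" "continuous_on S G'"
    using G unfolding C1_on_def by blast
  have [continuous_intros]: "continuous_on S G" "continuous_on S \<Psi>" "continuous_on S \<Psi>'" "continuous_on S G'"
    "continuous_on S (divergence_at G)"
    using G \<Psi>_cont \<Psi> G' C1_on_continuous_on C1_on_continuous_on_divergence by (auto intro: continuous_on_subset)
  show int1: "integrable lborel (\<lambda>y. \<Psi> y * divergence_at G y)"
    by (rule integrable_compact_support[OF * N(1)]) (auto simp: supp intro!: continuous_intros)
  show int2: "integrable lborel (\<lambda>y. \<Psi>' y (G y))"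
    by (rule integrable_compact_support[OF * N(1)]) (auto simp: supp' intro!: continuous_intros)
  define u where "u b y = \<Psi> y * (G y \<bullet> b)" for b y
  \<comment> \<open>\<open>G'\<close> is meaningless outside \<open>S\<close>. The product formula
    still holds everywhere, because \<open>\<Psi>\<close> and its derivative vanish off
    \<open>N\<close>.\<close>
  define u' where "u' b y v = (if y \<in> N then \<Psi>' y v * (G y \<bullet> b) + \<Psi> y * (G' y v \<bullet> b) else 0)" for b y v
  have u': "u' b y v = \<Psi>' y v * (G y \<bullet> b) + \<Psi> y * (G' y v \<bullet> b)" for b y v
    by (simp add: u'_def supp supp')
  have u: "(u b has_derivative u' b y) (at y)" for b y
  proof (cases "y \<in> N")
    case True
    then have "y \<in> S" using N by blast
    from G'(1)[OF this] \<Psi>(1) show ?thesis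
      unfolding u_def u'[abs_def] by (auto intro!: derivative_eq_intros)
  next
    case False
    have "(u b has_derivative (\<lambda>_. 0)) (at y)"
      by (rule has_derivative_transform_within_open[of "\<lambda>_. 0" _ _ _ "- N"])
        (use False N_cl supp in \<open>auto simp: u_def\<close>)
    moreover have "u' b y = (\<lambda>_. 0)" using False by (auto simp: u'_def)
    ultimately show ?thesis by simp
  qed
  have u'_cont: "continuous_on UNIV (\<lambda>y. u' b y v)" for b v
  proof (rule *)
    show "continuous_on S (\<lambda>y. u' b y v)"
      unfolding u' by (intro continuous_intros)
  qed (simp add: u'_def)
  have u_supp: "u b y = 0" if "y \<notin> N" for b y
    using supp[OF that] by (simp add: u_def)
  note int_u = integral_directional_derivative_eq_0[OF u u'_cont N(1) u_supp]
  have eq: "(\<Sum>b\<in>Basis. u' b y b) = \<Psi>' y (G y) + \<Psi> y * divergence_at G y" for y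
  proof (cases "y \<in> N")
    case True
    then have "divergence_at G y = (\<Sum>b\<in>Basis. G' y b \<bullet> b)"
      using N by (intro divergence_at_eq G') auto
    moreover have "\<Psi>' y (G y) = (\<Sum>b\<in>Basis. \<Psi>' y b * (G y \<bullet> b))"
    proof -
      have "\<Psi>' y (G y) = \<Psi>' y (\<Sum>b\<in>Basis. (G y \<bullet> b) *\<^sub>R b)"
        by (simp add: euclidean_representation)
      also have "\<dots> = (\<Sum>b\<in>Basis. \<Psi>' y b * (G y \<bullet> b))"
        by (simp only: blinfun.sum_right blinfun.scaleR_right real_scaleR_def mult.commute)
      finally show ?thesis .
    qed
    ultimately show ?thesis
      by (simp add: u' sum.distrib sum_distrib_left)
  qed (simp add: u'_def supp supp')
  have "(\<integral>y. (\<Sum>b\<in>Basis. u' b y b) \<partial>lborel) = (\<Sum>b\<in>Basis. \<integral>y. u' b y b \<partial>lborel)"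
    by (rule Bochner_Integration.integral_sum) (rule int_u(1))
  then have "(\<integral>y. \<Psi>' y (G y) + \<Psi> y * divergence_at G y \<partial>lborel) = 0"
    by (simp add: eq int_u(2))
  then show "(\<integral>y. \<Psi> y * divergence_at G y \<partial>lborel) = - (\<integral>y. \<Psi>' y (G y) \<partial>lborel)"
    using int1 int2 by simp
qed

section \<open>Smoothing by averages over small translations\<close>

lemma DERIV_max_0_power2: "((\<lambda>s::real. (max 0 s)\<^sup>2) has_real_derivative 2 * max 0 s) (at s)"
proof -
  \<comment> \<open>The remainder is at most \<open>h\<^sup>2\<close> in every combination of signs
    of \<open>s\<close> and \<open>s + h\<close>; the kink of the positive part is absorbed by the
    square.\<close>
  have "\<bar>(max 0 (s + h))\<^sup>2 - (max 0 s)\<^sup>2 - 2 * max 0 s * h\<bar> \<le> h\<^sup>2" for h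
  proof (cases "0 \<le> s"; cases "0 \<le> s + h")
    assume *: "0 \<le> s" "\<not> 0 \<le> s + h"
    then have "0 \<le> s * (- s - 2 * h)" "0 \<le> (s + h)\<^sup>2"
      by (auto intro!: mult_nonneg_nonneg)
    with * show ?thesis by (auto simp: power2_eq_square algebra_simps)
  next
    assume *: "\<not> 0 \<le> s" "0 \<le> s + h"
    then have "(s + h)\<^sup>2 \<le> h\<^sup>2" by (intro power_mono) auto
    with * show ?thesis by simp
  qed (auto simp: power2_eq_square algebra_simps)
  then have *: "\<bar>((max 0 (s + h))\<^sup>2 - (max 0 s)\<^sup>2) / h - 2 * max 0 s\<bar> \<le> \<bar>h\<bar>" if "h \<noteq> 0" for h
  proof -
    have "\<bar>((max 0 (s + h))\<^sup>2 - (max 0 s)\<^sup>2) / h - 2 * max 0 s\<bar>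
        = \<bar>(max 0 (s + h))\<^sup>2 - (max 0 s)\<^sup>2 - 2 * max 0 s * h\<bar> / \<bar>h\<bar>"
      using that by (simp add: abs_divide[symmetric] diff_divide_distrib)
    also have "\<dots> \<le> h\<^sup>2 / \<bar>h\<bar>"
      by (rule divide_right_mono) (use \<open>\<And>h. \<bar>(max 0 (s + h))\<^sup>2 - (max 0 s)\<^sup>2 - 2 * max 0 s * h\<bar> \<le> h\<^sup>2\<close> in auto)
    also have "\<dots> = \<bar>h\<bar>"
      by (simp add: power2_eq_square divide_simps abs_if)
    finally show ?thesis .
  qed
  have "((\<lambda>h. ((max 0 (s + h))\<^sup>2 - (max 0 s)\<^sup>2) / h - 2 * max 0 s) \<longlongrightarrow> 0) (at 0)"
  proof (rule Lim_null_comparison)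
    show "\<forall>\<^sub>F h in at 0. norm (((max 0 (s + h))\<^sup>2 - (max 0 s)\<^sup>2) / h - 2 * max 0 s) \<le> \<bar>h\<bar>"
      using * by (auto simp: eventually_at intro!: exI[of _ 1])
    show "(abs \<longlongrightarrow> 0) (at (0::real))"
      using tendsto_rabs_zero[OF tendsto_ident_at[of 0 UNIV]] by simp
  qed
  then show ?thesis
    unfolding DERIV_def by (rule LIM_zero_cancel)
qed

text \<open>The kernel is the normalised square of
  \<open>max 0 (\<epsilon>\<^sup>2 - z \<bullet> z)\<close>: a continuously differentiable bump
  suffices here. Packaging it as a probability measure hides its formula, so that pointwise
  inequalities for translates of \<open>\<psi>\<close> can simply be averaged.\<close>

lemma mollifying_measure:
  assumes \<epsilon>: "0 < \<epsilon>"
  obtains \<nu> :: "'a::euclidean_space measure" where "prob_space \<nu>" "sets \<nu> = sets borel"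
    "AE z in \<nu>. norm z \<le> \<epsilon>"
    "\<And>\<psi> :: 'a \<Rightarrow> real. continuous_on UNIV \<psi> \<Longrightarrow> bounded {x. \<psi> x \<noteq> 0} \<Longrightarrow> C1_on UNIV (\<lambda>y. \<integral>z. \<psi> (y + z) \<partial>\<nu>)"
proof -
  define m where "m z = max 0 (\<epsilon>\<^sup>2 - z \<bullet> z)" for z :: 'a
  define e where "e z = (m z)\<^sup>2" for z
  have m_cont: "continuous_on S (\<lambda>x. m (f x))" if "continuous_on S f" for S :: "'b::metric_space set" and f
    unfolding m_def using that by (intro continuous_intros)
  have e_cont: "continuous_on S (\<lambda>x. e (f x))" if "continuous_on S f" for S :: "'b::metric_space set" and f
    unfolding e_def using that by (intro continuous_intros m_cont)
  have [measurable]: "e \<in> borel_measurable borel"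
    by (rule borel_measurable_continuous_onI[OF e_cont[OF continuous_on_id]])
  have e_nonneg: "0 \<le> e z" for z by (simp add: e_def)
  have e_out: "e z = 0" if "\<epsilon> < norm z" for z
  proof -
    have "\<epsilon>\<^sup>2 \<le> (norm z)\<^sup>2" using that \<epsilon> by (intro power_mono) auto
    then show ?thesis by (simp add: e_def m_def power2_norm_eq_inner)
  qed
  have e_in: "e z \<noteq> 0" if "norm z < \<epsilon>" for z
  proof -
    have "(norm z)\<^sup>2 < \<epsilon>\<^sup>2" using that \<epsilon> by (intro power_strict_mono) auto
    then show ?thesis by (simp add: e_def m_def power2_norm_eq_inner)
  qed
  have e_int: "integrable lborel e"
    by (rule integrable_compact_support[OF e_cont[OF continuous_on_id] compact_cball[of 0 \<epsilon>]])
      (auto intro: e_out)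
  define c where "c = (\<integral>z. e z \<partial>lborel)"
  have "c \<noteq> 0"
  proof
    assume "c = 0"
    then have "AE z in lborel. e z = 0"
      using integral_nonneg_eq_0_iff_AE[OF e_int] e_nonneg by (simp add: c_def)
    then have "AE z in lborel. z \<notin> ball (0::'a) \<epsilon>"
      by eventually_elim (use e_in in auto)
    then have "ball (0::'a) \<epsilon> \<in> null_sets lborel"
      by (subst AE_iff_null_sets) auto
    then have "negligible (ball (0::'a) \<epsilon>)"
      by (simp add: negligible_iff_null_sets null_sets_completionI)
    then show False
      using open_not_negligible[of "ball (0::'a) \<epsilon>"] \<epsilon> by simp
  qed
  moreover have "0 \<le> c" unfolding c_def by (rule Bochner_Integration.integral_nonneg) (rule e_nonneg)
  ultimately have c: "0 < c" by simp
  define \<nu> where "\<nu> = density lborel (\<lambda>z. ennreal (e z / c))"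
  show ?thesis
  proof (rule that[of \<nu>])
    show "prob_space \<nu>"
    proof (rule prob_spaceI)
      have "emeasure \<nu> (space \<nu>) = (\<integral>\<^sup>+z. ennreal (e z / c) \<partial>lborel)"
        unfolding \<nu>_def by (subst emeasure_density) auto
      also have "\<dots> = ennreal (\<integral>z. e z / c \<partial>lborel)"
        using e_int c e_nonneg by (intro nn_integral_eq_integral) auto
      also have "(\<integral>z. e z / c \<partial>lborel) = 1"
        using c by (simp add: c_def)
      finally show "emeasure \<nu> (space \<nu>) = 1" by simp
    qed
    show "sets \<nu> = sets borel" by (simp add: \<nu>_def)
    show "AE z in \<nu>. norm z \<le> \<epsilon>"
    proof -
      have "norm z \<le> \<epsilon>" if "0 < ennreal (e z / c)" for z
        using that e_out[of z] by (cases "\<epsilon> < norm z") auto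
      then show ?thesis
        unfolding \<nu>_def by (subst AE_density) auto
    qed
    fix \<psi> :: "'a \<Rightarrow> real"
    assume \<psi>: "continuous_on UNIV \<psi>" and bdd: "bounded {x. \<psi> x \<noteq> 0}"
    obtain a b where ab: "{x. \<psi> x \<noteq> 0} \<subseteq> cbox a b"
      using bounded_subset_cbox_symmetric[OF bdd] by blast
    have \<psi>_cont: "continuous_on S (\<lambda>x. \<psi> (f x))" if "continuous_on S f" for S :: "'b::metric_space set" and f
      using continuous_on_compose2[OF \<psi> that] by simp
    have [measurable]: "\<psi> \<in> borel_measurable borel"
      by (rule borel_measurable_continuous_onI[OF \<psi>])
    \<comment> \<open>After the substitution \<open>x = y + z\<close> the parameter \<open>y\<close>
      occurs only in the kernel. Differentiation under the integral then falls on the kernel, so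
      continuity of \<open>\<psi>\<close> is enough, and the domain is a fixed box containing the
      support of \<open>\<psi>\<close>.\<close>
    define k where "k y x = \<psi> x / c * e (x - y)" for y x
    define k' where "k' y x = (\<psi> x * (4 * m (x - y)) / c) *\<^sub>R blinfun_inner_right (x - y)" for y x
    have k_cont: "continuous_on S (\<lambda>x. k (f x) (g x))"
      if "continuous_on S f" "continuous_on S g" for S :: "'b::metric_space set" and f g
      unfolding k_def using that c by (intro continuous_intros e_cont \<psi>_cont) auto
    have eq: "(\<integral>z. \<psi> (y + z) \<partial>\<nu>) = integral (cbox a b) (k y)" for y
    proof -
      have "(\<integral>z. \<psi> (y + z) \<partial>\<nu>) = (\<integral>z. k y (y + z) \<partial>lborel)"
        unfolding \<nu>_def using c e_nonneg by (subst integral_density) (auto simp: k_def mult.commute)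
      also have "\<dots> = (\<integral>x. k y x \<partial>lborel)"
        by (rule lborel_integral_translation) (simp add: k_def)
      also have "\<dots> = (LINT x:cbox a b|lborel. k y x)"
        unfolding set_lebesgue_integral_def
        by (rule Bochner_Integration.integral_cong) (use ab in \<open>auto simp: k_def indicator_def\<close>)
      also have "\<dots> = integral (cbox a b) (k y)"
      proof (rule set_borel_integral_eq_integral)
        show "set_integrable lborel (cbox a b) (k y)"
          unfolding set_integrable_def
          by (rule borel_integrable_compact[OF compact_cbox]) (intro k_cont continuous_intros)
      qed
      finally show ?thesis .
    qed
    have k': "((\<lambda>y. k y x) has_derivative blinfun_apply (k' y x)) (at y)" for x y
    proof -
      have i: "((\<lambda>y. \<epsilon>\<^sup>2 - (x - y) \<bullet> (x - y)) has_derivative (\<lambda>v. 2 * ((x - y) \<bullet> v))) (at y)"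
        by (auto intro!: derivative_eq_intros simp: inner_commute algebra_simps)
      have "((\<lambda>y. e (x - y)) has_derivative (\<lambda>v. 2 * m (x - y) * (2 * ((x - y) \<bullet> v)))) (at y)"
        unfolding e_def m_def
        by (rule has_derivative_compose[OF i, where g = "\<lambda>s. (max 0 s)\<^sup>2", OF DERIV_max_0_power2[unfolded has_field_derivative_def]])
      then have "((\<lambda>y. k y x) has_derivative (\<lambda>v. \<psi> x / c * (2 * m (x - y) * (2 * ((x - y) \<bullet> v))))) (at y)"
        unfolding k_def by (rule has_derivative_mult_right)
      moreover have "(\<lambda>v. \<psi> x / c * (2 * m (x - y) * (2 * ((x - y) \<bullet> v)))) = blinfun_apply (k' y x)"
        by (auto simp: k'_def scaleR_blinfun.rep_eq)
      ultimately show ?thesis by simp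
    qed
    have k'_cont: "continuous_on (UNIV \<times> cbox a b) (\<lambda>(y, x). k' y x)"
      unfolding k'_def split_beta
      using c by (intro continuous_intros \<psi>_cont m_cont bounded_linear.continuous_on[OF bounded_linear_blinfun_inner_right]) auto
    show "C1_on UNIV (\<lambda>y. \<integral>z. \<psi> (y + z) \<partial>\<nu>)"
      unfolding C1_on_def eq
    proof (intro exI conjI ballI)
      fix y :: 'a
      have kk: "integral (cbox a b) (k' y) = integral (cbox a b) (\<lambda>x. k' y x)" by simp
      show "((\<lambda>y. integral (cbox a b) (k y)) has_derivative blinfun_apply (integral (cbox a b) (k' y))) (at y)"
        using k' k'_cont
        by (intro leibniz_rule[of UNIV a b k k' y]) (auto intro!: integrable_continuous k_cont continuous_intros)
      show "continuous_on UNIV (\<lambda>y. integral (cbox a b) (k' y))"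
        by (rule integral_continuous_on_param[OF k'_cont])
    qed
  qed
qed

section \<open>Compact invariant sets are null\<close>

text \<open>Compare the step from \<open>w\<close> with the true solution from a nearest point
  \<open>p\<close> of \<open>S\<close>, which stays in \<open>S\<close>. The two starting points
  drift apart by at most the factor \<open>1 + L \<tau>\<close>. The solution has speed at most
  \<open>B\<close>, so \<open>h\<close> along it differs from \<open>h p\<close> by at most
  \<open>L B \<tau>\<close>; this gives the Euler error with \<open>C = L B\<close>.\<close>

lemma infdist_euler_step_le:
  fixes h :: "'a::euclidean_space \<Rightarrow> 'a"
  assumes L: "L-lipschitz_on X h" and S: "compact S" "S \<noteq> {}" "S \<subseteq> X"
    and inv: "\<And>p. p \<in> S \<Longrightarrow> \<exists>\<phi>. forward_solution h p \<phi> \<and> (\<forall>t\<ge>0. \<phi> t \<in> S)"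
  obtains C where "0 \<le> C"
    "\<And>w \<tau>. w \<in> X \<Longrightarrow> 0 \<le> \<tau> \<Longrightarrow> infdist (w + \<tau> *\<^sub>R h w) S \<le> (1 + L * \<tau>) * infdist w S + C * \<tau>\<^sup>2"
proof -
  have L0: "0 \<le> L" by (rule lipschitz_on_nonneg[OF L])
  have "continuous_on S h"
    using lipschitz_on_continuous_on[OF L] S(3) by (rule continuous_on_subset)
  then have "compact (h ` S)"
    using S(1) by (intro compact_continuous_image)
  then obtain B where B: "\<And>p. p \<in> S \<Longrightarrow> norm (h p) \<le> B"
    using compact_imp_bounded by (force simp: bounded_iff)
  have B0: "0 \<le> B" using B S(2) norm_ge_zero order_trans by blast
  show ?thesis
  proof (rule that[of "L * B"])
    show "0 \<le> L * B" using L0 B0 by simp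
    fix w \<tau> assume w: "w \<in> X" and \<tau>: "0 \<le> (\<tau>::real)"
    obtain p where p: "p \<in> S" "infdist w S = dist w p"
      using infdist_attains_inf[OF compact_imp_closed[OF S(1)] S(2)] by blast
    obtain \<phi> where \<phi>: "forward_solution h p \<phi>" and \<phi>S: "\<And>t. 0 \<le> t \<Longrightarrow> \<phi> t \<in> S"
      using inv[OF p(1)] by blast
    have \<phi>0: "\<phi> 0 = p" using \<phi> by (simp add: forward_solution_def)
    have \<phi>': "(\<phi> has_vector_derivative h (\<phi> t)) (at t within {0..s})" if "t \<in> {0..s}" for t s
      using \<phi> that by (auto simp: forward_solution_def intro: has_vector_derivative_within_subset)
    have drift: "norm (\<phi> s - p) \<le> B * s" if "0 \<le> s" for s
    proof -
      have "norm (\<phi> s - \<phi> 0) \<le> B * norm (s - 0)"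
      proof (rule differentiable_bound)
        show "convex {0..s}" by simp
        fix t assume t: "t \<in> {0..s}"
        show "(\<phi> has_derivative (\<lambda>x. x *\<^sub>R h (\<phi> t))) (at t within {0..s})"
          using \<phi>'[OF t] by (simp add: has_vector_derivative_def)
        show "onorm (\<lambda>x. x *\<^sub>R h (\<phi> t)) \<le> B"
          using mult_right_mono[OF B[OF \<phi>S[of t]] abs_ge_zero] t B0
          by (intro onorm_bound) (auto simp: mult.commute)
      qed (use that in auto)
      then show ?thesis using that by (simp add: \<phi>0)
    qed
    have "norm (\<phi> \<tau> - \<phi> 0 - (\<tau> - 0) *\<^sub>R h (\<phi> 0)) \<le> norm (\<tau> - 0) * (L * (B * \<tau>))"
    proof (rule vector_differentiable_bound_linearization[of "{0..\<tau>}"])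
      fix s assume s: "s \<in> {0..\<tau>}"
      have "norm (h (\<phi> s) - h (\<phi> 0)) \<le> L * norm (\<phi> s - \<phi> 0)"
        using lipschitz_on_normD[OF L] \<phi>S S(3) s by auto
      also have "\<dots> \<le> L * (B * s)"
        using drift s L0 \<phi>0 by (intro mult_left_mono) auto
      also have "\<dots> \<le> L * (B * \<tau>)"
        using s L0 B0 by (intro mult_left_mono) auto
      finally show "norm (h (\<phi> s) - h (\<phi> 0)) \<le> L * (B * \<tau>)" .
    qed (use \<tau> \<phi>' in \<open>auto simp: closed_segment_eq_real_ivl\<close>)
    then have euler: "norm (\<phi> \<tau> - p - \<tau> *\<^sub>R h p) \<le> L * B * \<tau>\<^sup>2"
      using \<tau> by (simp add: \<phi>0 power2_eq_square ac_simps)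
    have "infdist (w + \<tau> *\<^sub>R h w) S \<le> dist (w + \<tau> *\<^sub>R h w) (\<phi> \<tau>)"
      by (rule infdist_le[OF \<phi>S[OF \<tau>]])
    also have "\<dots> = norm ((w - p) + \<tau> *\<^sub>R (h w - h p) - (\<phi> \<tau> - p - \<tau> *\<^sub>R h p))"
      by (simp add: dist_norm algebra_simps)
    also have "\<dots> \<le> norm (w - p) + norm (\<tau> *\<^sub>R (h w - h p)) + norm (\<phi> \<tau> - p - \<tau> *\<^sub>R h p)"
      by (intro norm_triangle_le_diff add_mono norm_triangle_ineq order_refl)
    also have "\<dots> \<le> norm (w - p) + \<tau> * (L * norm (w - p)) + L * B * \<tau>\<^sup>2"
      using lipschitz_on_normD[OF L w, of p] p(1) S(3) \<tau> euler
      by (intro add_mono order_refl) (auto intro!: mult_left_mono)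
    finally show "infdist (w + \<tau> *\<^sub>R h w) S \<le> (1 + L * \<tau>) * infdist w S + L * B * \<tau>\<^sup>2"
      by (simp add: p(2) dist_norm algebra_simps)
  qed
qed

text \<open>The mollified cutoff \<open>max 0 (1 - k dist(y, S))\<close>: forward invariance of \<open>S\<close> keeps its derivative
  along \<open>h\<close> bounded below independently of \<open>k\<close>, with a bound that vanishes on \<open>S\<close>.\<close>

lemma smooth_cutoff_of_invariant_set:
  fixes h :: "'a::euclidean_space \<Rightarrow> 'a"
  assumes L: "L-lipschitz_on X h" and S: "compact S" "S \<noteq> {}"
    and X: "\<And>y. infdist y S \<le> 1 / k + \<epsilon> \<Longrightarrow> y \<in> X"
    and inv: "\<And>p. p \<in> S \<Longrightarrow> \<exists>\<phi>. forward_solution h p \<phi> \<and> (\<forall>t\<ge>0. \<phi> t \<in> S)"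
    and k: "0 < k" and \<epsilon>: "0 < \<epsilon>"
  obtains \<Psi> :: "'a \<Rightarrow> real" and \<Psi>' where
    "\<And>y. (\<Psi> has_derivative blinfun_apply (\<Psi>' y)) (at y)" "continuous_on UNIV \<Psi>'"
    "\<And>y. 0 \<le> \<Psi> y" "\<And>y. \<Psi> y \<le> 1" "\<And>y. 1 / k + \<epsilon> < infdist y S \<Longrightarrow> \<Psi> y = 0"
    "\<And>y. y \<in> S \<Longrightarrow> 1 - k * \<epsilon> \<le> \<Psi> y"
    "\<And>y. - L * (min 1 (k * infdist y S) + 2 * k * \<epsilon>) \<le> \<Psi>' y (h y)"
proof -
  have L0: "0 \<le> L" by (rule lipschitz_on_nonneg[OF L])
  have SX: "S \<subseteq> X" using X k \<epsilon> by (auto simp: add_nonneg_pos less_imp_le)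
  obtain C where C: "0 \<le> C"
    "\<And>w \<tau>. w \<in> X \<Longrightarrow> 0 \<le> \<tau> \<Longrightarrow> infdist (w + \<tau> *\<^sub>R h w) S \<le> (1 + L * \<tau>) * infdist w S + C * \<tau>\<^sup>2"
    using infdist_euler_step_le[OF L S SX inv] by blast
  define \<psi> where "\<psi> w = max 0 (1 - k * infdist w S)" for w
  have \<psi>_range: "0 \<le> \<psi> w" "\<psi> w \<le> 1" for w
    using k infdist_nonneg[of w S] by (auto simp: \<psi>_def)
  have \<psi>_cont: "continuous_on UNIV \<psi>"
    unfolding \<psi>_def by (intro continuous_intros)
  have \<psi>_out: "\<psi> w = 0" if "1 / k \<le> infdist w S" for w
    using that k by (simp add: \<psi>_def field_simps)
  have bdd: "bounded {w. \<psi> w \<noteq> 0}"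
  proof (rule bounded_subset)
    show "bounded {w. infdist w S \<le> 1 / k}"
      using compact_infdist_le[OF S(2,1), of "1 / k"] k by (intro compact_imp_bounded) auto
    show "{w. \<psi> w \<noteq> 0} \<subseteq> {w. infdist w S \<le> 1 / k}"
      using \<psi>_out by force
  qed
  obtain \<nu> :: "'a measure" where \<nu>: "prob_space \<nu>" "sets \<nu> = sets borel" "AE z in \<nu>. norm z \<le> \<epsilon>"
    "\<And>\<psi> :: 'a \<Rightarrow> real. continuous_on UNIV \<psi> \<Longrightarrow> bounded {x. \<psi> x \<noteq> 0} \<Longrightarrow> C1_on UNIV (\<lambda>y. \<integral>z. \<psi> (y + z) \<partial>\<nu>)"
    using mollifying_measure[OF \<epsilon>] by blast
  interpret prob_space \<nu> by (rule \<nu>(1))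
  define \<Psi> where "\<Psi> y = (\<integral>z. \<psi> (y + z) \<partial>\<nu>)" for y
  obtain \<Psi>' where \<Psi>': "\<And>y. (\<Psi> has_derivative blinfun_apply (\<Psi>' y)) (at y)" "continuous_on UNIV \<Psi>'"
    using \<nu>(4)[OF \<psi>_cont bdd] unfolding C1_on_def \<Psi>_def[symmetric] by auto
  have int: "integrable \<nu> (\<lambda>z. \<psi> (y + z))" for y
  proof (rule integrable_const_bound[where B = 1])
    have "(\<lambda>z. \<psi> (y + z)) \<in> borel_measurable borel"
      by (rule borel_measurable_continuous_onI) (intro continuous_on_compose2[OF \<psi>_cont] continuous_intros, auto)
    then show "(\<lambda>z. \<psi> (y + z)) \<in> borel_measurable \<nu>"
      using \<nu>(2) measurable_cong_sets by blast
  qed (use \<psi>_range in auto)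
  have dist_shift: "\<bar>infdist (y + z) S - infdist y S\<bar> \<le> \<epsilon>" if "norm z \<le> \<epsilon>" for y z
    using infdist_triangle_abs[of "y + z" S y] that by (simp add: dist_norm)
  have \<Psi>_nonneg: "0 \<le> \<Psi> y" for y
    unfolding \<Psi>_def by (rule Bochner_Integration.integral_nonneg) (rule \<psi>_range)
  have \<Psi>_le: "\<Psi> y \<le> 1" for y
    using integral_mono[OF int[of y] integrable_const[of 1]] \<psi>_range by (simp add: \<Psi>_def prob_space)
  have \<Psi>_out: "\<Psi> y = 0" if "1 / k + \<epsilon> < infdist y S" for y
  proof -
    have "AE z in \<nu>. \<psi> (y + z) = 0"
      using \<nu>(3)
    proof eventually_elim
      case (elim z)
      then show ?case using dist_shift[OF elim, of y] that by (intro \<psi>_out) linarith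
    qed
    then have "\<Psi> y = (\<integral>z. 0 \<partial>\<nu>)"
      unfolding \<Psi>_def by (intro integral_cong_AE borel_measurable_integrable[OF int]) auto
    then show ?thesis by simp
  qed
  have \<Psi>_in: "1 - k * \<epsilon> \<le> \<Psi> y" if "y \<in> S" for y
  proof -
    have "AE z in \<nu>. 1 - k * \<epsilon> \<le> \<psi> (y + z)"
      using \<nu>(3)
    proof eventually_elim
      case (elim z)
      have "infdist (y + z) S \<le> \<epsilon>"
        using dist_shift[OF elim, of y] that by simp
      then have "k * infdist (y + z) S \<le> k * \<epsilon>" using k by simp
      then show ?case by (simp add: \<psi>_def)
    qed
    then have "(\<integral>z. 1 - k * \<epsilon> \<partial>\<nu>) \<le> \<Psi> y"
      unfolding \<Psi>_def by (intro integral_mono_AE integrable_const int)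
    then show ?thesis by (simp add: prob_space)
  qed
  have \<Psi>_deriv: "- L * (min 1 (k * infdist y S) + 2 * k * \<epsilon>) \<le> \<Psi>' y (h y)" for y
  proof (cases "infdist y S \<le> 1 / k + \<epsilon>")
    case False
    have "closed {y. infdist y S \<le> 1 / k + \<epsilon>}"
      by (intro closed_Collect_le continuous_intros)
    then have "blinfun_apply (\<Psi>' y) = (\<lambda>_. 0)"
      by (rule has_derivative_zero_outside_support[OF \<Psi>'(1)]) (use False \<Psi>_out in auto)
    then show ?thesis
      using L0 k \<epsilon> infdist_nonneg[of y S] by (auto intro!: mult_nonneg_nonneg add_nonneg_nonneg)
  next
    case True
    then have yX: "y \<in> X" by (rule X)
    define a where "a = L * (min 1 (k * infdist y S) + 2 * k * \<epsilon>)"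
    \<comment> \<open>The step uses \<open>h y\<close> at all translates \<open>w = y + z\<close>.
      Replacing \<open>h w\<close> by \<open>h y\<close> costs \<open>L * \<epsilon>\<close>, and
      replacing the distance of \<open>w\<close> by that of \<open>y\<close> costs another
      \<open>\<epsilon>\<close>: hence \<open>2 * k * \<epsilon>\<close> in \<open>a\<close>. Where
      \<open>\<psi> w = 0\<close> the claim is only nonnegativity.\<close>
    have step: "\<psi> (y + z) - \<tau> * (a + k * C * \<tau>) \<le> \<psi> (y + \<tau> *\<^sub>R h y + z)"
      if z: "norm z \<le> \<epsilon>" and \<tau>: "0 < \<tau>" for z \<tau>
    proof (cases "1 / k \<le> infdist (y + z) S")
      case True
      have "0 \<le> a" using L0 k \<epsilon> infdist_nonneg[of y S] by (auto simp: a_def intro!: mult_nonneg_nonneg add_nonneg_nonneg)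
      then have "0 \<le> \<tau> * (a + k * C * \<tau>)" using \<tau> k C(1) by simp
      then show ?thesis using \<psi>_out[OF True] \<psi>_range(1)[of "y + \<tau> *\<^sub>R h y + z"] by simp
    next
      case False
      define w where "w = y + z"
      define d where "d = infdist w S"
      have d: "0 \<le> d" "d < 1 / k" using False by (auto simp: d_def w_def infdist_nonneg)
      \<comment> \<open>Source of the cap \<open>min 1\<close> in the bound: where
        \<open>\<psi>\<close> is positive, \<open>k * d\<close> cannot exceed \<open>1\<close>,
        however large \<open>k\<close> is.\<close>
      have kd: "k * d \<le> 1" using d k by (simp add: field_simps)
      have wX: "w \<in> X" using d \<epsilon> by (intro X) (simp add: d_def)
      have "k * d \<le> k * (infdist y S + \<epsilon>)"
        using dist_shift[OF z, of y] k by (intro mult_left_mono) (auto simp: d_def w_def)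
      moreover have "0 \<le> k * \<epsilon>" using k \<epsilon> by simp
      ultimately have kdy: "k * d \<le> min 1 (k * infdist y S) + k * \<epsilon>"
        using kd by (auto simp: distrib_left min_def)
      have hh: "norm (h y - h w) \<le> L * \<epsilon>"
        using lipschitz_on_normD[OF L yX wX] mult_left_mono[OF z L0] by (simp add: w_def)
      have "infdist (w + \<tau> *\<^sub>R h y) S \<le> infdist (w + \<tau> *\<^sub>R h w) S + dist (w + \<tau> *\<^sub>R h y) (w + \<tau> *\<^sub>R h w)"
        by (rule infdist_triangle)
      also have "dist (w + \<tau> *\<^sub>R h y) (w + \<tau> *\<^sub>R h w) = \<tau> * norm (h y - h w)"
        using \<tau> by (simp add: dist_norm scaleR_diff_right[symmetric])
      also have "\<dots> \<le> \<tau> * (L * \<epsilon>)"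
        using hh \<tau> by (intro mult_left_mono) auto
      also have "infdist (w + \<tau> *\<^sub>R h w) S \<le> (1 + L * \<tau>) * d + C * \<tau>\<^sup>2"
        unfolding d_def using C(2)[OF wX] \<tau> by simp
      finally have "k * infdist (w + \<tau> *\<^sub>R h y) S \<le> k * ((1 + L * \<tau>) * d + C * \<tau>\<^sup>2 + \<tau> * (L * \<epsilon>))"
        using k by (intro mult_left_mono) auto
      also have "\<dots> = k * d + \<tau> * (L * (k * d + k * \<epsilon>) + k * C * \<tau>)"
        by (simp add: algebra_simps power2_eq_square)
      also have "\<dots> \<le> k * d + \<tau> * (L * (min 1 (k * infdist y S) + k * \<epsilon> + k * \<epsilon>) + k * C * \<tau>)"
        using kdy L0 \<tau> by (intro add_mono mult_left_mono order_refl) auto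
      also have "\<dots> = k * d + \<tau> * (a + k * C * \<tau>)"
        by (simp add: a_def algebra_simps)
      finally have "1 - k * d - \<tau> * (a + k * C * \<tau>) \<le> \<psi> (w + \<tau> *\<^sub>R h y)"
        by (simp add: \<psi>_def)
      moreover have "\<psi> w = 1 - k * d" using kd by (simp add: \<psi>_def d_def[symmetric])
      ultimately show ?thesis by (simp add: w_def add_ac)
    qed
    \<comment> \<open>The average of \<open>step\<close> over \<open>z\<close>. The quadratic Euler
      error survives only as \<open>k * C * \<tau>\<close> and disappears as \<open>\<tau>\<close>
      tends to \<open>0\<close>, so \<open>C\<close> does not enter the final bound.\<close>
    have quot: "- a \<le> (\<Psi> (y + \<tau> *\<^sub>R h y) - \<Psi> y) / \<tau> + k * C * \<tau>" if \<tau>: "0 < \<tau>" for \<tau>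
    proof -
      have "(\<integral>z. \<psi> (y + z) - \<tau> * (a + k * C * \<tau>) \<partial>\<nu>) \<le> \<Psi> (y + \<tau> *\<^sub>R h y)"
        unfolding \<Psi>_def
      proof (rule integral_mono_AE)
        show "AE z in \<nu>. \<psi> (y + z) - \<tau> * (a + k * C * \<tau>) \<le> \<psi> (y + \<tau> *\<^sub>R h y + z)"
          using \<nu>(3) by eventually_elim (rule step[OF _ \<tau>])
      qed (intro Bochner_Integration.integrable_diff int integrable_const)+
      then have "\<Psi> y - \<tau> * (a + k * C * \<tau>) \<le> \<Psi> (y + \<tau> *\<^sub>R h y)"
        using int[of y] by (simp add: \<Psi>_def prob_space)
      then show ?thesis using \<tau> by (simp add: field_simps)
    qed
    have "((\<lambda>s. y + s *\<^sub>R h y) has_derivative (\<lambda>s. s *\<^sub>R h y)) (at 0)"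
      by (auto intro!: derivative_eq_intros)
    from has_derivative_compose[OF this, of \<Psi> "\<Psi>' y"]
    have "((\<lambda>s. \<Psi> (y + s *\<^sub>R h y)) has_derivative (\<lambda>s. s * \<Psi>' y (h y))) (at 0)"
      using \<Psi>'(1) by (simp add: blinfun.scaleR_right)
    then have "((\<lambda>s. \<Psi> (y + s *\<^sub>R h y)) has_real_derivative \<Psi>' y (h y)) (at 0)"
      by (simp add: has_field_derivative_def mult_commute_abs)
    then have "((\<lambda>\<tau>. (\<Psi> (y + \<tau> *\<^sub>R h y) - \<Psi> y) / \<tau>) \<longlongrightarrow> \<Psi>' y (h y)) (at 0)"
      by (simp add: DERIV_def)
    then have "((\<lambda>\<tau>. (\<Psi> (y + \<tau> *\<^sub>R h y) - \<Psi> y) / \<tau>) \<longlongrightarrow> \<Psi>' y (h y)) (at_right 0)"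
      by (rule tendsto_within_subset) simp
    then have "((\<lambda>\<tau>. (\<Psi> (y + \<tau> *\<^sub>R h y) - \<Psi> y) / \<tau> + k * C * \<tau>) \<longlongrightarrow> \<Psi>' y (h y) + k * C * 0) (at_right 0)"
      by (intro tendsto_intros)
    moreover have "\<forall>\<^sub>F \<tau> in at_right 0. - a \<le> (\<Psi> (y + \<tau> *\<^sub>R h y) - \<Psi> y) / \<tau> + k * C * \<tau>"
      using quot by (auto simp: eventually_at_filter)
    ultimately have "- a \<le> \<Psi>' y (h y) + k * C * 0"
      by (rule tendsto_lowerbound) simp
    then show ?thesis by (simp add: a_def)
  qed
  show ?thesis
    by (rule that[OF \<Psi>' \<Psi>_nonneg \<Psi>_le \<Psi>_out \<Psi>_in \<Psi>_deriv])
qed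

text \<open>Heuristically, the mass of \<open>S\<close> with density \<open>\<rho>\<close> would
  strictly grow along the flow if \<open>S\<close> had positive measure, since the divergence is
  positive there; but the flow maps \<open>S\<close> into itself. The cutoffs test this balance
  without moving \<open>S\<close>.\<close>

lemma negligible_compact_invariant_set:
  fixes h :: "'a::euclidean_space \<Rightarrow> 'a" and \<rho> :: "'a \<Rightarrow> real"
  assumes lip: "\<And>r. \<exists>L. L-lipschitz_on (cball 0 r) h"
    and S: "compact S" and Q: "open Q" "S \<subseteq> Q"
    and \<rho>: "continuous_on Q \<rho>" "\<And>y. y \<in> Q \<Longrightarrow> 0 \<le> \<rho> y"
    and G: "C1_on Q (\<lambda>y. \<rho> y *\<^sub>R h y)"
    and inv: "\<And>p. p \<in> S \<Longrightarrow> \<exists>\<phi>. forward_solution h p \<phi> \<and> (\<forall>t\<ge>0. \<phi> t \<in> S)"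
    and pos: "\<And>y. y \<in> S \<Longrightarrow> 0 < divergence_at (\<lambda>y. \<rho> y *\<^sub>R h y) y"
  shows "negligible S"
proof (cases "S = {}")
  case ne: False
  define G where "G y = \<rho> y *\<^sub>R h y" for y
  define d where "d y = infdist y S" for y
  have d_cont: "continuous_on UNIV d"
    unfolding d_def by (intro continuous_intros)
  have d_nonneg: "0 \<le> d y" for y by (simp add: d_def infdist_nonneg)
  obtain \<eta> where \<eta>: "0 < \<eta>" "(\<Union>p\<in>S. ball p \<eta>) \<subseteq> Q"
    using compact_subset_open_imp_ball_epsilon_subset[OF S Q] by blast
  \<comment> \<open>A fixed compact neighbourhood inside \<open>Q\<close> that carries the supports
    of all cutoffs; \<open>\<rho>\<close> and its divergence are bounded on it.\<close>
  define N where "N = {y. d y \<le> \<eta> / 2}"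
  have N: "compact N"
    unfolding N_def d_def using compact_infdist_le[OF ne S, of "\<eta> / 2"] \<eta>(1) by simp
  have NQ: "N \<subseteq> Q"
  proof
    fix y assume "y \<in> N"
    obtain p where "p \<in> S" "infdist y S = dist y p"
      using infdist_attains_inf[OF compact_imp_closed[OF S] ne] by blast
    then show "y \<in> Q" using \<open>y \<in> N\<close> \<eta> by (force simp: N_def d_def dist_commute)
  qed
  have in_S: "y \<in> S \<longleftrightarrow> d y = 0" for y
    unfolding d_def using in_closed_iff_infdist_zero[OF compact_imp_closed[OF S] ne] .
  obtain r where "\<forall>y\<in>N. norm y \<le> r"
    using compact_imp_bounded[OF N] unfolding bounded_iff by blast
  then have r: "N \<subseteq> cball 0 r" by auto
  obtain L where L: "L-lipschitz_on (cball 0 r) h" using lip by blast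
  have L0: "0 \<le> L" by (rule lipschitz_on_nonneg[OF L])
  \<comment> \<open>The summand \<open>4 / \<eta>\<close> puts the support radius
    \<open>2 / k n\<close> below \<open>\<eta> / 2\<close>. The summand \<open>1\<close> gives
    \<open>k n \<ge> 1\<close>, hence \<open>\<epsilon> n \<le> 1 / k n\<close> and the domination
    constant \<open>3 = 1 + 2\<close> below.\<close>
  define k where "k n = real n + 1 + 4 / \<eta>" for n
  \<comment> \<open>A mollification radius of smaller order than the cutoff width
    \<open>1 / k n\<close>: the errors are multiples of \<open>k n * \<epsilon> n = 1 / k n\<close>
    and vanish in the limit.\<close>
  define \<epsilon> where "\<epsilon> n = 1 / (k n)\<^sup>2" for n
  have k1: "1 \<le> k n" and k0: "0 < k n" for n using \<eta>(1) by (auto simp: k_def add_pos_nonneg)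
  have \<epsilon>0: "0 < \<epsilon> n" for n using k0[of n] by (simp add: \<epsilon>_def)
  have k\<epsilon>: "k n * \<epsilon> n = 1 / k n" for n
    using k0[of n] by (simp add: \<epsilon>_def power2_eq_square)
  have \<epsilon>_le: "\<epsilon> n \<le> 1 / k n" for n
    using k1[of n] by (simp add: \<epsilon>_def power2_eq_square divide_simps)
  have k\<eta>: "2 / k n \<le> \<eta> / 2" for n
  proof -
    have "4 / \<eta> \<le> k n" by (simp add: k_def)
    then show ?thesis using \<eta>(1) k0[of n] by (simp add: field_simps)
  qed
  have lim_k: "(\<lambda>n. c / k n) \<longlonglongrightarrow> 0" for c
  proof (rule real_tendsto_divide_at_top[OF tendsto_const])
    show "filterlim k at_top sequentially"
      by (rule filterlim_at_top_mono[OF filterlim_real_sequentially])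
        (use \<eta>(1) in \<open>simp add: k_def add_nonneg_nonneg\<close>)
  qed
  have sub_N: "y \<in> N" if "d y \<le> 2 / k n" for n y
    using order_trans[OF that k\<eta>] by (simp add: N_def)
  have X: "y \<in> cball 0 r" if "infdist y S \<le> 1 / k n + \<epsilon> n" for n y
  proof -
    have "d y \<le> 2 / k n" using that \<epsilon>_le[of n] by (simp add: d_def)
    then show ?thesis using sub_N r by blast
  qed
  \<comment> \<open>Bundled, with the constants already simplified, so that one choice selects the
    cutoffs and their derivatives for all \<open>n\<close>.\<close>
  define P where "P n \<Psi> \<Psi>' \<longleftrightarrow>
    (\<forall>y. (\<Psi> has_derivative blinfun_apply (\<Psi>' y)) (at y)) \<and> continuous_on UNIV \<Psi>' \<and>
    (\<forall>y. 0 \<le> \<Psi> y) \<and> (\<forall>y. \<Psi> y \<le> 1) \<and> (\<forall>y. 2 / k n < d y \<longrightarrow> \<Psi> y = 0) \<and>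
    (\<forall>y. y \<in> S \<longrightarrow> 1 - 1 / k n \<le> \<Psi> y) \<and>
    (\<forall>y. - L * (min 1 (k n * d y) + 2 / k n) \<le> \<Psi>' y (h y))" for n and \<Psi> :: "'a \<Rightarrow> real" and \<Psi>'
  have "\<exists>\<Psi> \<Psi>'. P n \<Psi> \<Psi>'" for n
  proof (rule smooth_cutoff_of_invariant_set[OF L S ne _ _ k0[of n] \<epsilon>0[of n]])
    show "y \<in> cball 0 r" if "infdist y S \<le> 1 / k n + \<epsilon> n" for y
      using that by (rule X)
    show "\<exists>\<phi>. forward_solution h p \<phi> \<and> (\<forall>t\<ge>0. \<phi> t \<in> S)" if "p \<in> S" for p
      using that by (rule inv)
    fix \<Psi> :: "'a \<Rightarrow> real" and \<Psi>'
    assume *: "\<And>y. (\<Psi> has_derivative blinfun_apply (\<Psi>' y)) (at y)" "continuous_on UNIV \<Psi>'"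
      "\<And>y. 0 \<le> \<Psi> y" "\<And>y. \<Psi> y \<le> 1" "\<And>y. 1 / k n + \<epsilon> n < infdist y S \<Longrightarrow> \<Psi> y = 0"
      "\<And>y. y \<in> S \<Longrightarrow> 1 - k n * \<epsilon> n \<le> \<Psi> y"
      "\<And>y. - L * (min 1 (k n * infdist y S) + 2 * k n * \<epsilon> n) \<le> \<Psi>' y (h y)"
    have "\<Psi> y = 0" if "2 / k n < d y" for y
      using that \<epsilon>_le[of n] by (intro *(5)) (simp add: d_def)
    moreover have k\<epsilon>2: "2 * k n * \<epsilon> n = 2 / k n" using k\<epsilon>[of n] by simp
    ultimately have "P n \<Psi> \<Psi>'"
      unfolding P_def using *(1-4) *(6)[unfolded k\<epsilon>] *(7)[unfolded k\<epsilon>2] by (simp add: d_def)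
    then show ?thesis by blast
  qed
  then obtain \<Psi> \<Psi>' where P: "\<And>n. P n (\<Psi> n) (\<Psi>' n)" by metis
  have \<Psi>': "(\<Psi> n has_derivative blinfun_apply (\<Psi>' n y)) (at y)" "continuous_on UNIV (\<Psi>' n)" for n y
    using P[of n] by (auto simp: P_def)
  have \<Psi>_range: "0 \<le> \<Psi> n y" "\<Psi> n y \<le> 1" for n y using P[of n] by (auto simp: P_def)
  have \<Psi>_out: "\<Psi> n y = 0" if "2 / k n < d y" for n y using P[of n] that by (auto simp: P_def)
  have \<Psi>_in: "1 - 1 / k n \<le> \<Psi> n y" if "y \<in> S" for n y using P[of n] that by (auto simp: P_def)
  have \<Psi>_deriv: "- L * (min 1 (k n * d y) + 2 / k n) \<le> \<Psi>' n y (h y)" for n y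
    using P[of n] by (auto simp: P_def)
  have \<Psi>_supp: "\<Psi> n y = 0" if "y \<notin> N" for n y
    using that k\<eta>[of n] by (intro \<Psi>_out) (auto simp: N_def)
  have GQ: "C1_on Q G" unfolding G_def by (rule G)
  note parts = integral_divergence_by_parts[OF \<Psi>' Q(1) GQ N NQ \<Psi>_supp]
  have div_int: "integrable lborel (\<lambda>y. indicator N y *\<^sub>R \<bar>divergence_at G y\<bar>)"
    using C1_on_continuous_on_divergence[OF GQ] NQ
    by (intro borel_integrable_compact N continuous_intros) (auto intro: continuous_on_subset)
  have \<rho>_int: "integrable lborel (\<lambda>y. indicator N y *\<^sub>R (\<rho> y * (3 * L)))"
    using \<rho>(1) NQ by (intro borel_integrable_compact N continuous_intros) (auto intro: continuous_on_subset)
  \<comment> \<open>A majorant of \<open>- \<Psi>' n y (G y)\<close> that tends to \<open>0\<close>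
    at every point: on \<open>S\<close> only the term with \<open>2 / k n\<close> is left, and a
    point off \<open>S\<close> eventually leaves the shrinking neighbourhood.\<close>
  define b where "b n y = indicator {y. d y \<le> 2 / k n} y * (indicator N y *\<^sub>R (\<rho> y * (L * (min 1 (k n * d y) + 2 / k n))))" for n y
  have [measurable]: "d \<in> borel_measurable borel"
    by (rule borel_measurable_continuous_onI[OF d_cont])
  have \<rho>_meas: "(\<lambda>y. indicator N y *\<^sub>R \<rho> y) \<in> borel_measurable borel"
    using \<rho>(1) NQ borel_compact[OF N]
    by (intro borel_measurable_continuous_on_indicator) (auto intro: continuous_on_subset)
  have b_meas: "b n \<in> borel_measurable lborel" for n
  proof -
    \<comment> \<open>Regrouped so that \<open>\<rho>\<close> occurs only multiplied by the
      indicator of \<open>N\<close>: it is continuous on \<open>Q\<close>, and nothing is known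
      about it elsewhere.\<close>
    have "b n = (\<lambda>y. indicator {y. d y \<le> 2 / k n} y * ((indicator N y *\<^sub>R \<rho> y) * (L * (min 1 (k n * d y) + 2 / k n))))"
      by (auto simp: b_def fun_eq_iff)
    then show ?thesis using \<rho>_meas by simp
  qed
  have b_bound: "norm (b n y) \<le> indicator N y *\<^sub>R (\<rho> y * (3 * L))" for n y
  proof (cases "y \<in> N")
    case True
    then have \<rho>y: "0 \<le> \<rho> y" using \<rho>(2) NQ by blast
    define c where "c = min 1 (k n * d y) + 2 / k n"
    have "c \<le> 1 + 2"
      unfolding c_def using k1[of n] by (intro add_mono) (auto simp: divide_simps)
    then have "L * c \<le> 3 * L"
      using mult_left_mono[of c 3 L] L0 by (simp add: mult.commute)
    moreover have "0 \<le> L * c"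
      using L0 k0[of n] d_nonneg[of y] unfolding c_def by (intro mult_nonneg_nonneg add_nonneg_nonneg) auto
    ultimately have "0 \<le> \<rho> y * (L * c)" "\<rho> y * (L * c) \<le> \<rho> y * (3 * L)"
      using \<rho>y by (auto intro: mult_nonneg_nonneg mult_left_mono)
    then show ?thesis
      using True \<rho>y L0 unfolding b_def c_def[symmetric] by (cases "d y \<le> 2 / k n") auto
  qed (simp add: b_def)
  have b_lim: "(\<lambda>n. b n y) \<longlonglongrightarrow> 0" for y
  proof (cases "y \<in> S")
    case True
    then have dy: "d y = 0" using in_S by simp
    then have "b n y = (indicator N y * \<rho> y * L * 2) / k n" for n
      using k0[of n] by (simp add: b_def)
    then show ?thesis using lim_k by presburger
  next
    case False
    then have "0 < d y" using in_S d_nonneg[of y] by (simp add: order_less_le)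
    then have "\<forall>\<^sub>F n in sequentially. 2 / k n < d y"
      using lim_k[of 2] by (simp add: order_tendstoD)
    then have "\<forall>\<^sub>F n in sequentially. b n y = 0"
      by eventually_elim (simp add: b_def)
    then show ?thesis by (rule tendsto_eventually)
  qed
  have "(\<lambda>n. \<integral>y. b n y \<partial>lborel) \<longlonglongrightarrow> (\<integral>y. 0 \<partial>(lborel :: 'a measure))"
  proof (rule integral_dominated_convergence)
    show "integrable lborel (\<lambda>y. indicator N y *\<^sub>R (\<rho> y * (3 * L)))" by (rule \<rho>_int)
    show "b n \<in> borel_measurable lborel" for n by (rule b_meas)
    show "AE y in lborel. norm (b n y) \<le> indicator N y *\<^sub>R (\<rho> y * (3 * L))" for n
      by (intro AE_I2 b_bound)
    show "AE y in lborel. (\<lambda>n. b n y) \<longlonglongrightarrow> 0"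
      by (intro AE_I2 b_lim)
  qed simp
  then have b_int_lim: "(\<lambda>n. \<integral>y. b n y \<partial>lborel) \<longlonglongrightarrow> 0" by simp
  have b_int: "integrable lborel (b n)" for n
    by (rule Bochner_Integration.integrable_bound[OF \<rho>_int b_meas]) (use b_bound in \<open>auto intro!: AE_I2 intro: order_trans[OF _ abs_ge_self]\<close>)
  have le: "(\<integral>y. \<Psi> n y * divergence_at G y \<partial>lborel) \<le> (\<integral>y. b n y \<partial>lborel)" for n
  proof -
    have "(\<integral>y. \<Psi> n y * divergence_at G y \<partial>lborel) = (\<integral>y. - \<Psi>' n y (G y) \<partial>lborel)"
      by (simp add: parts(3))
    also have "\<dots> \<le> (\<integral>y. b n y \<partial>lborel)"
    proof (rule integral_mono)
      show "integrable lborel (\<lambda>y. - \<Psi>' n y (G y))"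
        using parts(2) by simp
      show "integrable lborel (b n)" by (rule b_int)
      fix y
      show "- \<Psi>' n y (G y) \<le> b n y"
      proof (cases "d y \<le> 2 / k n")
        case True
        then have yN: "y \<in> N" by (rule sub_N)
        then have "\<rho> y * (- \<Psi>' n y (h y)) \<le> \<rho> y * (L * (min 1 (k n * d y) + 2 / k n))"
          using \<Psi>_deriv[of n y] \<rho>(2) NQ by (intro mult_left_mono) auto
        then show ?thesis
          using True yN by (simp add: b_def G_def blinfun.scaleR_right)
      next
        case False
        have "closed {y. d y \<le> 2 / k n}"
          using d_cont by (intro closed_Collect_le continuous_intros)
        then have "blinfun_apply (\<Psi>' n y) = (\<lambda>_. 0)"
          by (rule has_derivative_zero_outside_support[OF \<Psi>'(1)]) (use False \<Psi>_out in auto)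
        then show ?thesis using False by (simp add: b_def)
      qed
    qed
    finally show ?thesis .
  qed
  have \<Psi>_lim: "(\<lambda>n. \<Psi> n y) \<longlonglongrightarrow> indicator S y" for y
  proof (cases "y \<in> S")
    case True
    have "(\<lambda>n. \<Psi> n y) \<longlonglongrightarrow> 1"
    proof (rule tendsto_sandwich)
      show "(\<lambda>n. 1 - 1 / k n) \<longlonglongrightarrow> 1"
        using tendsto_diff[OF tendsto_const[of 1] lim_k[of 1]] by simp
    qed (use \<Psi>_range \<Psi>_in[OF True] in auto)
    then show ?thesis using True by simp
  next
    case False
    then have "0 < d y" using in_S d_nonneg[of y] by (simp add: order_less_le)
    then have "\<forall>\<^sub>F n in sequentially. 2 / k n < d y"
      using lim_k[of 2] by (simp add: order_tendstoD)
    then have "\<forall>\<^sub>F n in sequentially. \<Psi> n y = 0"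
      by eventually_elim (rule \<Psi>_out)
    then show ?thesis using False by (simp add: tendsto_eventually)
  qed
  have SN: "S \<subseteq> N" using in_S \<eta>(1) by (auto simp: N_def)
  have div_S: "integrable lborel (\<lambda>y. indicator S y *\<^sub>R divergence_at G y)"
    using C1_on_continuous_on_divergence[OF GQ] Q(2)
    by (intro borel_integrable_compact S continuous_intros) (auto intro: continuous_on_subset)
  have "(\<lambda>n. \<integral>y. \<Psi> n y * divergence_at G y \<partial>lborel) \<longlonglongrightarrow> (\<integral>y. indicator S y *\<^sub>R divergence_at G y \<partial>lborel)"
  proof (rule integral_dominated_convergence)
    show "integrable lborel (\<lambda>y. indicator N y *\<^sub>R \<bar>divergence_at G y\<bar>)" by (rule div_int)
    show "(\<lambda>y. \<Psi> n y * divergence_at G y) \<in> borel_measurable lborel" for n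
      using parts(1) by (rule borel_measurable_integrable)
    show "(\<lambda>y. indicator S y *\<^sub>R divergence_at G y) \<in> borel_measurable lborel"
      using div_S by (rule borel_measurable_integrable)
    show "AE y in lborel. (\<lambda>n. \<Psi> n y * divergence_at G y) \<longlonglongrightarrow> indicator S y *\<^sub>R divergence_at G y"
      using \<Psi>_lim by (auto intro!: AE_I2 tendsto_mult_right)
    show "AE y in lborel. norm (\<Psi> n y * divergence_at G y) \<le> indicator N y *\<^sub>R \<bar>divergence_at G y\<bar>" for n
    proof (rule AE_I2)
      fix y
      show "norm (\<Psi> n y * divergence_at G y) \<le> indicator N y *\<^sub>R \<bar>divergence_at G y\<bar>"
        using \<Psi>_range[of n y] \<Psi>_supp[of y n]
        by (cases "y \<in> N") (auto simp: abs_mult intro: mult_left_le_one_le)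
    qed
  qed
  from LIMSEQ_le[OF this b_int_lim] le
  have "(\<integral>y. indicator S y *\<^sub>R divergence_at G y \<partial>lborel) \<le> 0" by blast
  moreover have posG: "0 < divergence_at G y" if "y \<in> S" for y
    using pos[OF that] by (simp add: G_def[abs_def])
  have nonneg: "0 \<le> indicator S y *\<^sub>R divergence_at G y" for y
    using posG[of y] by (cases "y \<in> S") auto
  moreover have "0 \<le> (\<integral>y. indicator S y *\<^sub>R divergence_at G y \<partial>lborel)"
    by (rule Bochner_Integration.integral_nonneg) (rule nonneg)
  ultimately have "(\<integral>y. indicator S y *\<^sub>R divergence_at G y \<partial>lborel) = 0" by linarith
  then have "AE y in lborel. indicator S y *\<^sub>R divergence_at G y = 0"
    using integral_nonneg_eq_0_iff_AE[OF div_S] nonneg by simp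
  then have "AE y in lborel. y \<notin> S"
    by eventually_elim (use posG in \<open>auto simp: indicator_def split: if_splits dest: posG\<close>)
  then have "S \<in> null_sets lborel"
    using S by (subst AE_iff_null_sets) (auto intro: borel_compact)
  then show ?thesis
    by (simp add: negligible_iff_null_sets null_sets_completionI)
qed simp

section \<open>Local stability\<close>

lemma class_Kinf_less:
  assumes "class_Kinf \<gamma>" "0 \<le> s" "s < t" shows "\<gamma> s < \<gamma> t"
  using assms unfolding class_Kinf_def strict_mono_on_def by auto

lemma class_Kinf_le:
  assumes "class_Kinf \<gamma>" "0 \<le> s" "s \<le> t" shows "\<gamma> s \<le> \<gamma> t"
  using class_Kinf_less[OF assms(1,2), of t] assms(3) by (cases "s = t") auto

lemma class_Kinf_0: "class_Kinf \<gamma> \<Longrightarrow> \<gamma> 0 = 0"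
  by (simp add: class_Kinf_def)

lemma class_Kinf_pos: "class_Kinf \<gamma> \<Longrightarrow> 0 < s \<Longrightarrow> 0 < \<gamma> s"
  using class_Kinf_less[of \<gamma> 0 s] class_Kinf_0[of \<gamma>] by simp

text \<open>To the right of \<open>s\<close> continuity keeps the values below \<open>c\<close>, to
  the left monotonicity does. It turns a strict gain inequality into room for choosing the sides of
  a box.\<close>

lemma class_Kinf_right_less:
  assumes \<gamma>: "class_Kinf \<gamma>" and s: "0 \<le> s" "\<gamma> s < c"
  obtains e where "0 < e" "\<And>t. 0 \<le> t \<Longrightarrow> t < s + e \<Longrightarrow> \<gamma> t < c"
proof -
  have "(\<gamma> \<longlongrightarrow> \<gamma> s) (at s within {0..})"
    using \<gamma> s(1) unfolding class_Kinf_def continuous_on_def by auto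
  from order_tendstoD(2)[OF this s(2)]
  obtain e where e: "0 < e" "\<And>t. t \<in> {0..} \<Longrightarrow> t \<noteq> s \<Longrightarrow> dist t s < e \<Longrightarrow> \<gamma> t < c"
    unfolding eventually_at by blast
  have "\<gamma> t < c" if "0 \<le> t" "t < s + e" for t
  proof (cases "t \<le> s")
    case True
    then show ?thesis using class_Kinf_le[OF \<gamma> that(1) True] s(2) by simp
  next
    case False
    then show ?thesis using e(2)[of t] that by (simp add: dist_real_def)
  qed
  then show ?thesis using that e(1) by blast
qed

lemma storage_function_continuous_on:
  assumes "storage_function V"
  shows "continuous_on UNIV V"
proof -
  have "local_lipschitz UNIV UNIV (\<lambda>_::real. V)"
    using assms by (simp add: storage_function_def locally_lipschitz_on_def)
  from local_lipschitz_continuous_on[OF this, of 0] show ?thesis by simp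
qed

lemma storage_function_0:
  assumes "storage_function V"
  shows "V 0 = 0"
proof -
  obtain a b where "class_Kinf a" "class_Kinf b" "\<forall>x. a (norm x) \<le> V x \<and> V x \<le> b (norm x)"
    using assms unfolding storage_function_def by blast
  then show ?thesis by (metis class_Kinf_0 norm_zero order_antisym)
qed

lemma storage_function_sublevel:
  assumes "storage_function V" "0 < \<epsilon>"
  obtains c where "0 < c" "\<And>x. V x \<le> c \<Longrightarrow> norm x < \<epsilon>"
proof -
  obtain a where a: "class_Kinf a" "\<And>x. a (norm x) \<le> V x"
    using assms unfolding storage_function_def by blast
  have pos: "0 < a \<epsilon>" by (rule class_Kinf_pos[OF a(1) assms(2)])
  have "norm x < \<epsilon>" if "V x \<le> a \<epsilon> / 2" for x
  proof (rule ccontr)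
    assume "\<not> norm x < \<epsilon>"
    then have "a \<epsilon> \<le> a (norm x)" using assms(2) by (intro class_Kinf_le[OF a(1)]) auto
    then show False using a(2)[of x] that pos by simp
  qed
  then show ?thesis using that[of "a \<epsilon> / 2"] pos by simp
qed

text \<open>The Dini derivative is taken along the ray \<open>x + \<tau> v\<close>, to which the
  curve \<open>\<xi>\<close> is only tangent. The Lipschitz bound of \<open>V\<close> near
  \<open>x\<close> turns the tangency error into a term of order \<open>o(\<tau>)\<close>, too small
  to cancel the drop along the ray.\<close>

lemma dini_derivative_neg_imp_decreasing:
  fixes V :: "'a::euclidean_space \<Rightarrow> real"
  assumes V: "locally_lipschitz_on UNIV V" and dini: "dini_derivative V (\<xi> t) v \<le> ereal (- l)" and l: "0 < l"
    and \<xi>: "(\<xi> has_vector_derivative v) (at t within {t..})"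
  shows "\<exists>b>t. \<forall>s. t < s \<and> s < b \<longrightarrow> V (\<xi> s) < V (\<xi> t)"
proof -
  define x where "x = \<xi> t"
  obtain u K0 where u: "0 < u"
    and "\<And>s. s \<in> cball (0::real) u \<inter> UNIV \<Longrightarrow> K0-lipschitz_on (cball x u \<inter> UNIV) V"
    using V unfolding locally_lipschitz_on_def by (rule local_lipschitzE[of _ _ _ 0 x]) auto
  from this(2)[of 0] u have K0: "K0-lipschitz_on (cball x u) V" by simp
  define K where "K = K0 + 1"
  have K: "0 < K" using lipschitz_on_nonneg[OF K0] by (simp add: K_def)
  have lipK: "K-lipschitz_on (cball x u) V"
    by (rule lipschitz_on_mono[OF K0]) (simp_all add: K_def)
  have "Limsup (at_right 0) (\<lambda>\<tau>. ereal ((V (x + \<tau> *\<^sub>R v) - V x) / \<tau>)) < ereal (- l / 2)"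
    using dini unfolding dini_derivative_def x_def by (rule order_le_less_trans) (use l in simp)
  from Limsup_lessD[OF this] obtain b1 where b1: "0 < b1"
    "\<And>\<tau>. 0 < \<tau> \<Longrightarrow> \<tau> < b1 \<Longrightarrow> (V (x + \<tau> *\<^sub>R v) - V x) / \<tau> < - l / 2"
    unfolding eventually_at_right_field by auto
  \<comment> \<open>Tangency error \<open>e * \<tau>\<close> times the Lipschitz constant
    \<open>K\<close> is \<open>l / 2 * \<tau>\<close>, while along the ray \<open>V\<close> drops by
    strictly more than that.\<close>
  define e where "e = l / (2 * K)"
  have e: "0 < e" using l K by (simp add: e_def)
  obtain b2 where b2: "0 < b2"
    "\<And>s. t \<le> s \<Longrightarrow> \<bar>s - t\<bar> < b2 \<Longrightarrow> norm (\<xi> s - \<xi> t - (s - t) *\<^sub>R v) \<le> e * \<bar>s - t\<bar>"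
    using \<xi> e unfolding has_vector_derivative_def has_derivative_within_alt by (auto simp: Ball_def)
  \<comment> \<open>The third bound keeps both the curve and the ray inside the ball on which
    \<open>V\<close> is Lipschitz.\<close>
  define b where "b = Min {b1, b2, u / (norm v + e + 1)}"
  have vpos: "0 < norm v + e + 1" using e by (simp add: add_nonneg_pos)
  have b: "0 < b" using b1 b2 u vpos by (simp add: b_def)
  show ?thesis
  proof (intro exI[of _ "t + b"] conjI allI impI)
    fix s assume s: "t < s \<and> s < t + b"
    define \<tau> where "\<tau> = s - t"
    have \<tau>: "0 < \<tau>" "\<tau> < b1" "\<tau> < b2" "\<tau> < u / (norm v + e + 1)"
      using s by (auto simp: \<tau>_def b_def)
    have err: "norm (\<xi> s - x - \<tau> *\<^sub>R v) \<le> e * \<tau>"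
      using b2(2)[of s] \<tau> by (simp add: \<tau>_def x_def)
    have "\<tau> * (norm v + e + 1) < u" using \<tau>(4) vpos by (simp add: field_simps)
    then have small: "\<tau> * norm v + e * \<tau> \<le> u" using \<tau>(1) by (simp add: algebra_simps)
    have "norm (\<xi> s - x) \<le> norm (\<xi> s - x - \<tau> *\<^sub>R v) + norm (\<tau> *\<^sub>R v)"
      using norm_triangle_ineq[of "\<xi> s - x - \<tau> *\<^sub>R v" "\<tau> *\<^sub>R v"] by simp
    then have in1: "\<xi> s \<in> cball x u"
      using err small \<tau>(1) by (simp add: dist_norm norm_minus_commute)
    have "0 \<le> e * \<tau>" using e \<tau>(1) by simp
    then have in2: "x + \<tau> *\<^sub>R v \<in> cball x u"
      using small \<tau>(1) by (simp add: dist_norm)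
    have "V (\<xi> s) - V (x + \<tau> *\<^sub>R v) \<le> K * norm (\<xi> s - (x + \<tau> *\<^sub>R v))"
      using lipschitz_on_normD[OF lipK in1 in2] by simp
    also have "\<dots> \<le> K * (e * \<tau>)"
      using err K by (intro mult_left_mono) (auto simp: algebra_simps)
    also have "\<dots> = l / 2 * \<tau>" using K by (simp add: e_def)
    finally have "V (\<xi> s) \<le> V (x + \<tau> *\<^sub>R v) + l / 2 * \<tau>" by simp
    moreover have "V (x + \<tau> *\<^sub>R v) - V x < - l / 2 * \<tau>"
      using b1(2)[OF \<tau>(1,2)] \<tau>(1) by (simp add: divide_less_eq)
    ultimately show "V (\<xi> s) < V (\<xi> t)" by (simp add: x_def)
  qed (use b in simp)
qed

text \<open>At the infimum of the times outside \<open>B\<close> closedness still places the curve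
  in \<open>B\<close>, and \<open>step\<close> keeps it there a little longer, contradicting the
  infimum.\<close>

lemma forward_invariant_closed:
  assumes \<phi>: "continuous_on {0..} (\<phi> :: real \<Rightarrow> 'a::topological_space)" and B: "closed B" and \<phi>0: "\<phi> 0 \<in> B"
    and step: "\<And>t. 0 \<le> t \<Longrightarrow> \<phi> t \<in> B \<Longrightarrow> \<exists>b>t. \<forall>s. t < s \<and> s < b \<longrightarrow> \<phi> s \<in> B"
    and t: "0 \<le> t"
  shows "\<phi> t \<in> B"
proof (rule ccontr)
  assume "\<phi> t \<notin> B"
  define E where "E = {s. 0 \<le> s \<and> \<phi> s \<notin> B}"
  have ne: "E \<noteq> {}" using \<open>\<phi> t \<notin> B\<close> t by (auto simp: E_def)
  have bb: "bdd_below E" by (rule bdd_belowI[of _ 0]) (simp add: E_def)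
  define T where "T = Inf E"
  have T0: "0 \<le> T" unfolding T_def using ne by (intro cInf_greatest) (auto simp: E_def)
  have below: "\<phi> s \<in> B" if "0 \<le> s" "s < T" for s
    using cInf_lower[OF _ bb, of s] that by (force simp: E_def T_def)
  have TB: "\<phi> T \<in> B"
  proof (cases "T = 0")
    case False
    then have "T \<in> closure {0..<T}" using T0 by simp
    moreover have "\<phi> ` closure {0..<T} \<subseteq> B"
      by (rule image_closure_subset[OF _ B])
        (use False T0 below in \<open>auto intro: continuous_on_subset[OF \<phi>]\<close>)
    ultimately show ?thesis by auto
  qed (simp add: \<phi>0)
  obtain b where b: "T < b" "\<And>s. T < s \<Longrightarrow> s < b \<Longrightarrow> \<phi> s \<in> B"
    using step[OF T0 TB] by blast
  obtain s where s: "s \<in> E" "s < b"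
    using cInf_lessD[OF ne, of b] b(1) by (auto simp: T_def)
  have "T \<le> s" unfolding T_def by (rule cInf_lower[OF s(1) bb])
  then show False using s b(2)[of s] TB by (cases "T = s") (auto simp: E_def)
qed

text \<open>For \<open>\<delta>(a) < b\<close> and \<open>\<gamma>(b) < a\<close> the vector field points into the box \<open>V \<le> a\<close>, \<open>W \<le> b\<close> on both kinds of
  faces.\<close>

lemma gain_condition_imp_lyapunov_stable:
  fixes f :: "'a::euclidean_space \<times> 'b::euclidean_space \<Rightarrow> 'a" and g :: "'a \<times> 'b \<Rightarrow> 'b"
  assumes pair: "iss_lyapunov_pair f g V W lam_x lam_z"
    and gain: "region_gain_condition f g V W lam_x lam_z 0 M 0 N \<gamma> \<delta>"
    and ex: "\<And>y. \<exists>\<phi>. forward_solution (interconnection f g) y \<phi>"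
  shows "lyapunov_stable (interconnection f g)"
  unfolding lyapunov_stable_def
proof (intro allI impI)
  fix \<epsilon> :: real assume \<epsilon>: "0 < \<epsilon>"
  have V: "storage_function V" and W: "storage_function W"
    and lam: "positive_definite lam_x" "positive_definite lam_z"
    using pair by (auto simp: iss_lyapunov_pair_def)
  have V_lip: "locally_lipschitz_on UNIV V" and W_lip: "locally_lipschitz_on UNIV W"
    and V_nonneg: "\<And>x. 0 \<le> V x" and W_nonneg: "\<And>z. 0 \<le> W z"
    using V W by (auto simp: storage_function_def)
  note V_cont = storage_function_continuous_on[OF V] and W_cont = storage_function_continuous_on[OF W]
  have \<gamma>: "class_Kinf \<gamma>" and \<delta>: "class_Kinf \<delta>" and M: "0 < M" and N: "0 < N"
    and dV: "\<And>x z. ereal (V x) \<le> M \<Longrightarrow> ereal (W z) \<le> N \<Longrightarrow> \<gamma> (W z) \<le> V x \<Longrightarrow>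
      dini_derivative V x (f (x, z)) \<le> ereal (- lam_x x)"
    and dW: "\<And>x z. ereal (V x) \<le> M \<Longrightarrow> ereal (W z) \<le> N \<Longrightarrow> \<delta> (V x) \<le> W z \<Longrightarrow>
      dini_derivative W z (g (x, z)) \<le> ereal (- lam_z z)"
    and small_gain: "\<And>s. 0 \<le> s \<Longrightarrow> ereal s \<le> M \<Longrightarrow> s \<noteq> 0 \<Longrightarrow> \<gamma> (\<delta> s) < s"
    using gain V_nonneg unfolding region_gain_condition_def gain_region_def by (auto simp: zero_ereal_def)
  obtain c1 where c1: "0 < c1" "\<And>x. V x \<le> c1 \<Longrightarrow> norm x < \<epsilon> / 2"
    using storage_function_sublevel[OF V, of "\<epsilon> / 2"] \<epsilon> by auto
  obtain c2 where c2: "0 < c2" "\<And>z. W z \<le> c2 \<Longrightarrow> norm z < \<epsilon> / 2"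
    using storage_function_sublevel[OF W, of "\<epsilon> / 2"] \<epsilon> by auto
  \<comment> \<open>\<open>M\<close> and \<open>N\<close> may be infinite; real numbers below them
    take part in the minima that define the box.\<close>
  obtain M' where M': "0 < M'" "ereal M' < M"
    using ereal_dense2[OF M] by (auto simp: zero_ereal_def)
  obtain N' where N': "0 < N'" "ereal N' < N"
    using ereal_dense2[OF N] by (auto simp: zero_ereal_def)
  have "\<delta> 0 < min c2 N'" using class_Kinf_0[OF \<delta>] c2 N' by simp
  then obtain e1 where e1: "0 < e1" "\<And>t. 0 \<le> t \<Longrightarrow> t < 0 + e1 \<Longrightarrow> \<delta> t < min c2 N'"
    using class_Kinf_right_less[OF \<delta> order_refl] by blast
  \<comment> \<open>\<open>a\<close> is fixed first, so small that \<open>\<delta> a\<close> stays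
    below the caps for \<open>b\<close>. The small-gain inequality
    \<open>\<gamma> (\<delta> a) < a\<close> then leaves an interval above \<open>\<delta> a\<close>
    from which \<open>b\<close> is taken.\<close>
  define a where "a = min (min c1 M') (e1 / 2)"
  have a: "0 < a" "a \<le> c1" "a \<le> M'" "a < e1" using c1 M' e1 by (auto simp: a_def)
  have aM: "ereal s \<le> M" if "s \<le> a" for s
    using that a(3) M'(2) order.trans[of "ereal s" "ereal M'" M] by simp
  have \<delta>a: "0 \<le> \<delta> a" "\<delta> a < min c2 N'" using class_Kinf_pos[OF \<delta> a(1)] e1(2)[of a] a by auto
  have "\<gamma> (\<delta> a) < a" using small_gain[of a] a(1) aM[of a] by simp
  then obtain e2 where e2: "0 < e2" "\<And>t. 0 \<le> t \<Longrightarrow> t < \<delta> a + e2 \<Longrightarrow> \<gamma> t < a"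
    using class_Kinf_right_less[OF \<gamma> \<delta>a(1)] by blast
  define b where "b = min (min c2 N') (\<delta> a + e2 / 2)"
  have b: "\<delta> a < b" "b \<le> c2" "b \<le> N'" "b < \<delta> a + e2" using \<delta>a e2(1) by (auto simp: b_def)
  have b0: "0 < b" using b(1) \<delta>a(1) by linarith
  have bN: "ereal s \<le> N" if "s \<le> b" for s
    using that b(3) N'(2) order.trans[of "ereal s" "ereal N'" N] by simp
  define B where "B = {y::'a \<times> 'b. V (fst y) \<le> a \<and> W (snd y) \<le> b}"
  define B' where "B' = {y::'a \<times> 'b. V (fst y) < a \<and> W (snd y) < b}"
  have c_fst: "continuous_on UNIV (\<lambda>y::'a \<times> 'b. V (fst y))" and c_snd: "continuous_on UNIV (\<lambda>y::'a \<times> 'b. W (snd y))"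
    by (auto intro!: continuous_on_compose2[OF V_cont] continuous_on_compose2[OF W_cont] continuous_intros)
  have isCont1: "isCont (\<lambda>y. V (fst y)) y" and isCont2: "isCont (\<lambda>y. W (snd y)) y" for y :: "'a \<times> 'b"
    using c_fst c_snd unfolding continuous_on_eq_continuous_at[OF open_UNIV] by blast+
  have "closed B" unfolding B_def
    by (intro closed_Collect_conj closed_Collect_le c_fst c_snd continuous_intros)
  have "open B'" unfolding B'_def
    by (intro open_Collect_conj open_Collect_less c_fst c_snd continuous_intros)
  moreover have "0 \<in> B'" using a(1) b0 storage_function_0[OF V] storage_function_0[OF W] by (simp add: B'_def)
  ultimately obtain r where r: "0 < r" "ball 0 r \<subseteq> B'"
    by (auto simp: open_contains_ball)
  show "\<exists>r>0. \<forall>y. norm y < r \<longrightarrow> (\<exists>\<phi>. forward_solution (interconnection f g) y \<phi> \<and> (\<forall>t\<ge>0. norm (\<phi> t) < \<epsilon>))"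
  proof (intro exI[of _ r] conjI allI impI r(1))
    fix y :: "'a \<times> 'b" assume "norm y < r"
    then have "y \<in> B'" using r by auto
    obtain \<phi> where \<phi>: "forward_solution (interconnection f g) y \<phi>" using ex by blast
    note \<phi>_cont = forward_solution_continuous_on[OF \<phi>]
    have \<phi>B: "\<phi> t \<in> B" if "0 \<le> t" for t
    proof (rule forward_invariant_closed[OF \<phi>_cont \<open>closed B\<close> _ _ that])
      show "\<phi> 0 \<in> B" using \<phi> \<open>y \<in> B'\<close> by (auto simp: forward_solution_def B_def B'_def)
      fix t assume t: "0 \<le> t" and tB: "\<phi> t \<in> B"
      define x where "x = fst (\<phi> t)"
      define z where "z = snd (\<phi> t)"
      have \<phi>t: "\<phi> t = (x, z)" by (simp add: x_def z_def)
      have xz: "V x \<le> a" "W z \<le> b" using tB by (auto simp: B_def x_def z_def)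
      have d: "(\<phi> has_vector_derivative (f (x, z), g (x, z))) (at t within {t..})"
      proof (rule has_vector_derivative_within_subset)
        show "(\<phi> has_vector_derivative (f (x, z), g (x, z))) (at t within {0..})"
          using \<phi> t unfolding forward_solution_def interconnection_def \<phi>t[symmetric] by blast
      qed (use t in auto)
      have "((\<lambda>s. fst (\<phi> s)) has_vector_derivative fst (f (x, z), g (x, z))) (at t within {t..})"
        by (rule bounded_linear.has_vector_derivative[OF bounded_linear_fst d])
      then have d1: "((\<lambda>s. fst (\<phi> s)) has_vector_derivative f (x, z)) (at t within {t..})" by simp
      have "((\<lambda>s. snd (\<phi> s)) has_vector_derivative snd (f (x, z), g (x, z))) (at t within {t..})"
        by (rule bounded_linear.has_vector_derivative[OF bounded_linear_snd d])
      then have d2: "((\<lambda>s. snd (\<phi> s)) has_vector_derivative g (x, z)) (at t within {t..})" by simp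
      have \<phi>_right: "(\<phi> \<longlongrightarrow> \<phi> t) (at_right t)"
        using \<phi>_cont t unfolding continuous_on_def by (auto intro: tendsto_within_subset)
      have \<phi>_right1: "((\<lambda>s. V (fst (\<phi> s))) \<longlongrightarrow> V x) (at_right t)"
        using isCont_tendsto_compose[OF isCont1 \<phi>_right] \<phi>t by simp
      have \<phi>_right2: "((\<lambda>s. W (snd (\<phi> s))) \<longlongrightarrow> W z) (at_right t)"
        using isCont_tendsto_compose[OF isCont2 \<phi>_right] \<phi>t by simp
      \<comment> \<open>Only the face \<open>V x = a\<close> matters; below it continuity suffices.
        On the face \<open>W z \<le> b\<close> yields
        \<open>\<gamma> (W z) \<le> \<gamma> b < a = V x\<close>, so the gain condition
        applies.\<close>
      have 1: "\<exists>b1>t. \<forall>s. t < s \<and> s < b1 \<longrightarrow> V (fst (\<phi> s)) \<le> a"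
      proof (cases "V x = a")
        case True
        have "\<gamma> (W z) \<le> V x"
          using class_Kinf_le[OF \<gamma> W_nonneg xz(2)] e2(2)[of b] b b0 True by simp
        then have "dini_derivative V x (f (x, z)) \<le> ereal (- lam_x x)"
          by (intro dV aM bN xz)
        moreover have "x \<noteq> 0" using True a(1) storage_function_0[OF V] by auto
        then have "0 < lam_x x" using lam(1) by (simp add: positive_definite_def)
        ultimately obtain b1 where "b1 > t" "\<forall>s. t < s \<and> s < b1 \<longrightarrow> V (fst (\<phi> s)) < V (fst (\<phi> t))"
          using dini_derivative_neg_imp_decreasing[OF V_lip _ _ d1] by (auto simp: x_def)
        then show ?thesis using True by (force simp: x_def)
      next
        case False
        then have "V x < a" using xz by simp
        from order_tendstoD(2)[OF \<phi>_right1 this] show ?thesis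
          unfolding eventually_at_right_field by (auto intro: less_imp_le)
      qed
      have 2: "\<exists>b2>t. \<forall>s. t < s \<and> s < b2 \<longrightarrow> W (snd (\<phi> s)) \<le> b"
      proof (cases "W z = b")
        case True
        have "\<delta> (V x) \<le> W z"
          using class_Kinf_le[OF \<delta> V_nonneg xz(1)] b(1) True by simp
        then have "dini_derivative W z (g (x, z)) \<le> ereal (- lam_z z)"
          by (intro dW aM bN xz)
        moreover have "z \<noteq> 0" using True b0 storage_function_0[OF W] by auto
        then have "0 < lam_z z" using lam(2) by (simp add: positive_definite_def)
        ultimately obtain b2 where "b2 > t" "\<forall>s. t < s \<and> s < b2 \<longrightarrow> W (snd (\<phi> s)) < W (snd (\<phi> t))"
          using dini_derivative_neg_imp_decreasing[OF W_lip _ _ d2] by (auto simp: z_def)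
        then show ?thesis using True by (force simp: z_def)
      next
        case False
        then have "W z < b" using xz by simp
        from order_tendstoD(2)[OF \<phi>_right2 this] show ?thesis
          unfolding eventually_at_right_field by (auto intro: less_imp_le)
      qed
      obtain b1 b2 where "b1 > t" "\<forall>s. t < s \<and> s < b1 \<longrightarrow> V (fst (\<phi> s)) \<le> a"
        "b2 > t" "\<forall>s. t < s \<and> s < b2 \<longrightarrow> W (snd (\<phi> s)) \<le> b"
        using 1 2 by blast
      then show "\<exists>b'>t. \<forall>s. t < s \<and> s < b' \<longrightarrow> \<phi> s \<in> B"
        by (intro exI[of _ "min b1 b2"]) (simp add: B_def)
    qed
    have "norm (\<phi> t) < \<epsilon>" if "0 \<le> t" for t
    proof -
      have "V (fst (\<phi> t)) \<le> c1" "W (snd (\<phi> t)) \<le> c2"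
        using \<phi>B[OF that] a(2) b(2) by (auto simp: B_def)
      then have "norm (fst (\<phi> t)) < \<epsilon> / 2" "norm (snd (\<phi> t)) < \<epsilon> / 2"
        by (blast intro: c1(2) c2(2))+
      then show ?thesis
        using norm_Pair_le[of "fst (\<phi> t)" "snd (\<phi> t)"] by simp
    qed
    then show "\<exists>\<phi>. forward_solution (interconnection f g) y \<phi> \<and> (\<forall>t\<ge>0. norm (\<phi> t) < \<epsilon>)"
      using \<phi> by blast
  qed
qed

section \<open>Almost global stability\<close>

text \<open>Positivity alone would allow \<open>U\<close> to become small far away. Properness
  reduces the question to a compact annulus, where \<open>U\<close> has a positive minimum.\<close>

lemma positive_definite_proper_bounded_away:
  fixes U :: "'a::euclidean_space \<Rightarrow> real"
  assumes U: "positive_definite U" "proper_function U" and \<epsilon>: "0 < \<epsilon>"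
  obtains c where "0 < c" "\<And>y. U y < c \<Longrightarrow> norm y < \<epsilon>"
proof -
  have cont: "continuous_on UNIV U" and U0: "U 0 = 0" and pos: "\<And>y. y \<noteq> 0 \<Longrightarrow> 0 < U y"
    using U(1) by (auto simp: positive_definite_def)
  have "\<forall>\<^sub>F y in at_infinity. 1 \<le> \<bar>U y\<bar>"
    using U(2) unfolding proper_function_def filterlim_at_top by blast
  then obtain R where R: "\<And>y. R \<le> norm y \<Longrightarrow> 1 \<le> \<bar>U y\<bar>"
    unfolding eventually_at_infinity by blast
  have Unn: "0 \<le> U y" for y using pos[of y] U0 by (cases "y = 0") auto
  define A where "A = cball 0 R - ball (0::'a) \<epsilon>"
  have A: "compact A" unfolding A_def by (intro compact_diff) auto
  have "\<exists>c>0. \<forall>y\<in>A. c \<le> U y"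
  proof (cases "A = {}")
    case False
    obtain y0 where y0: "y0 \<in> A" "\<And>y. y \<in> A \<Longrightarrow> U y0 \<le> U y"
      using continuous_attains_inf[OF A False continuous_on_subset[OF cont]] by blast
    have "y0 \<noteq> 0" using y0(1) \<epsilon> by (auto simp: A_def)
    then show ?thesis using pos y0(2) by blast
  qed (auto intro: exI[of _ 1])
  then obtain c where c: "0 < c" "\<And>y. y \<in> A \<Longrightarrow> c \<le> U y" by blast
  have "norm y < \<epsilon>" if "U y < min c 1" for y
  proof (rule ccontr)
    assume y: "\<not> norm y < \<epsilon>"
    have "norm y < R" using R[of y] that Unn[of y] by force
    then have "y \<in> A" using y by (simp add: A_def)
    then show False using c(2) that by force
  qed
  then show ?thesis using that[of "min c 1"] c(1) by simp
qed

lemma Limsup_le_0_imp_tendsto_0: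
  fixes U :: "'a::euclidean_space \<Rightarrow> real"
  assumes U: "positive_definite U" "proper_function U"
    and lim: "Limsup at_top (\<lambda>t. ereal (U (\<phi> t))) \<le> ereal 0"
  shows "((\<lambda>t. norm (\<phi> t)) \<longlongrightarrow> 0) (at_top :: real filter)"
proof (rule tendstoI)
  fix \<epsilon> :: real assume "0 < \<epsilon>"
  then obtain c where c: "0 < c" "\<And>y. U y < c \<Longrightarrow> norm y < \<epsilon>"
    using positive_definite_proper_bounded_away[OF U] by blast
  have "Limsup at_top (\<lambda>t. ereal (U (\<phi> t))) < ereal c"
    using lim by (rule order_le_less_trans) (use c in simp)
  from Limsup_lessD[OF this] show "\<forall>\<^sub>F t in at_top. dist (norm (\<phi> t)) 0 < \<epsilon>"
    by eventually_elim (use c(2) in simp)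
qed

lemma proper_sublevel_bounded:
  fixes U :: "'a::euclidean_space \<Rightarrow> real"
  assumes "proper_function U" "\<And>y. 0 \<le> U y"
  obtains R where "\<And>y. U y \<le> m \<Longrightarrow> norm y < R"
proof -
  have "\<forall>\<^sub>F y in at_infinity. m + 1 \<le> \<bar>U y\<bar>"
    using assms(1) unfolding proper_function_def filterlim_at_top by blast
  then obtain R where R: "\<And>y. R \<le> norm y \<Longrightarrow> m + 1 \<le> \<bar>U y\<bar>"
    unfolding eventually_at_infinity by blast
  have "norm y < R" if "U y \<le> m" for y
    using R[of y] assms(2)[of y] that by force
  then show ?thesis using that by blast
qed

lemma forward_solution_exists_of_region_lyapunov:
  fixes h :: "'a::euclidean_space \<Rightarrow> 'a"
  assumes h: "C1_on UNIV h" and U: "region_lyapunov_function h m \<infinity> U"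
  shows "\<exists>\<phi>. forward_solution h y \<phi>"
proof -
  obtain R where R: "\<And>y. U y \<le> m \<Longrightarrow> norm y < R"
    using proper_sublevel_bounded[of U m] U by (auto simp: region_lyapunov_function_def)
  show ?thesis
  proof (rule forward_solution_exists_if_far[OF C1_on_lipschitz_on_cball[OF h]])
    fix z :: 'a assume "R \<le> norm z"
    then have "m < U z" using R[of z] by force
    then show "\<exists>\<phi>. forward_solution h z \<phi>"
      using U unfolding region_lyapunov_function_def by auto
  qed
qed

lemma almost_global_stability_of_density:
  fixes h :: "'a::euclidean_space \<Rightarrow> 'a"
  assumes h: "C1_on UNIV h" and stable: "lyapunov_stable h"
    and Ul: "region_lyapunov_function h 0 M Ul" and M: "0 < M"
    and Ug: "region_lyapunov_function h m \<infinity> Ug"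
    and \<rho>: "C1_on (- {0}) \<rho>" "\<And>y. y \<noteq> 0 \<Longrightarrow> 0 \<le> \<rho> y"
    and supp: "density_region Ul M Ug m \<subseteq> support_on (- {0}) \<rho>"
    and div: "\<And>y. y \<in> density_region Ul M Ug m \<Longrightarrow> 0 < divergence_at (\<lambda>y. \<rho> y *\<^sub>R h y) y"
  shows "almost_globally_asymptotically_stable h"
proof -
  note lip = C1_on_lipschitz_on_cball[OF h]
  note ex = forward_solution_exists_of_region_lyapunov[OF h Ug]
  note unique = forward_solution_unique[OF lip]
  have Ul_props: "\<And>y. 0 \<le> Ul y" "proper_function Ul" "positive_definite Ul"
    and Ul_att: "\<And>y. 0 < Ul y \<Longrightarrow> ereal (Ul y) \<le> M \<Longrightarrow>
      \<exists>\<phi>. forward_solution h y \<phi> \<and> Limsup at_top (\<lambda>t. ereal (Ul (\<phi> t))) \<le> ereal 0"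
    using Ul by (auto simp: region_lyapunov_function_def)
  have Ug_props: "\<And>y. 0 \<le> Ug y" "proper_function Ug" "positive_definite Ug"
    and Ug_att: "\<And>y. m < Ug y \<Longrightarrow>
      \<exists>\<phi>. forward_solution h y \<phi> \<and> Limsup at_top (\<lambda>t. ereal (Ug (\<phi> t))) \<le> ereal m"
    using Ug by (auto simp: region_lyapunov_function_def)
  have Ul_cont: "continuous_on UNIV Ul" and Ug_cont: "continuous_on UNIV Ug"
    and Ul0: "Ul 0 = 0" and Ul_pos: "\<And>y. y \<noteq> 0 \<Longrightarrow> 0 < Ul y"
    using Ul_props Ug_props by (auto simp: positive_definite_def)
  define R where "R = density_region Ul M Ug m"
  define conv where "conv \<phi> \<longleftrightarrow> ((\<lambda>t. norm (\<phi> t)) \<longlongrightarrow> 0) at_top" for \<phi> :: "real \<Rightarrow> 'a"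
  \<comment> \<open>The hypotheses on \<open>Ul\<close> and on stability speak of some solution;
    uniqueness transfers their conclusions to the solution at hand.\<close>
  have conv_cong: "conv \<psi>" if "conv \<phi>" "forward_solution h y \<phi>" "forward_solution h y \<psi>" for \<phi> \<psi> y
  proof -
    have "\<forall>\<^sub>F t in at_top. norm (\<phi> t) = norm (\<psi> t)"
      using eventually_ge_at_top[of "0 :: real"] by eventually_elim (use unique[OF that(2,3)] in simp)
    then show ?thesis using that(1) unfolding conv_def by (rule Lim_transform_eventually[rotated])
  qed
  have basin: "conv \<phi>" if \<phi>: "forward_solution h y \<phi>" and y: "ereal (Ul y) \<le> M" for y \<phi>
  proof (cases "y = 0")
    case False
    then obtain \<psi> where "forward_solution h y \<psi>" "Limsup at_top (\<lambda>t. ereal (Ul (\<psi> t))) \<le> ereal 0"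
      using Ul_att[OF Ul_pos y] by blast
    then show ?thesis
      using conv_cong[of \<psi> y \<phi>] \<phi> Limsup_le_0_imp_tendsto_0[OF Ul_props(3,2)] by (simp add: conv_def)
  next
    \<comment> \<open>The origin is excluded by \<open>0 < Ul y\<close> in the attraction property.
      Lyapunov stability with arbitrary \<open>e\<close> shows that its solution is constantly
      zero.\<close>
    case True
    have zero: "norm (\<phi> t) \<le> 0" if t: "0 \<le> t" for t
    proof (rule field_le_epsilon)
      fix e :: real assume "0 < e"
      then obtain r where "0 < r" "\<And>y. norm y < r \<Longrightarrow> \<exists>\<phi>. forward_solution h y \<phi> \<and> (\<forall>t\<ge>0. norm (\<phi> t) < e)"
        using stable unfolding lyapunov_stable_def by blast
      then obtain \<psi> where "forward_solution h 0 \<psi>" "\<forall>t\<ge>0. norm (\<psi> t) < e"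
        by (metis norm_zero)
      then show "norm (\<phi> t) \<le> 0 + e"
        using unique[OF \<phi>[unfolded True], of \<psi> t] t by force
    qed
    have "\<forall>\<^sub>F t in at_top. norm (\<phi> t) = 0"
      using eventually_ge_at_top[of "0 :: real"] by eventually_elim (use zero in simp)
    then show ?thesis unfolding conv_def by (rule tendsto_eventually)
  qed
  have basin_later: "conv \<phi>" if \<phi>: "forward_solution h y \<phi>" and t: "0 \<le> t" and y: "ereal (Ul (\<phi> t)) \<le> M" for y \<phi> t
  proof -
    have "((\<lambda>s. norm (\<phi> (t + s))) \<longlongrightarrow> 0) at_top"
      using basin[OF forward_solution_shift[OF \<phi> t] y] by (simp add: conv_def)
    moreover have "filterlim (\<lambda>s. - t + s) at_top at_top"
      by (rule filterlim_tendsto_add_at_top[OF tendsto_const filterlim_ident])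
    ultimately have "((\<lambda>s. norm (\<phi> (t + (- t + s)))) \<longlongrightarrow> 0) at_top"
      by (rule filterlim_compose)
    then show ?thesis by (simp add: conv_def)
  qed
  \<comment> \<open>Either the solution never exceeds the level \<open>m\<close>, or it does so at
    some time and the attraction property applies from there.\<close>
  have Ug_limsup: "\<forall>\<^sub>F t in at_top. Ug (\<phi> t) < m + e" if \<phi>: "forward_solution h y \<phi>" and e: "0 < e" for y \<phi> e
  proof (cases "\<exists>t\<ge>0. m < Ug (\<phi> t)")
    case False
    then have "Ug (\<phi> t) \<le> m" if "0 \<le> t" for t using that by (simp add: not_less)
    then have "\<forall>t\<ge>0. Ug (\<phi> t) < m + e" using e by force
    then show ?thesis unfolding eventually_at_top_linorder by blast
  next
    case True
    then obtain t where t: "0 \<le> t" "m < Ug (\<phi> t)" by blast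
    obtain \<psi> where \<psi>: "forward_solution h (\<phi> t) \<psi>" "Limsup at_top (\<lambda>t. ereal (Ug (\<psi> t))) \<le> ereal m"
      using Ug_att[OF t(2)] by blast
    have "Limsup at_top (\<lambda>t. ereal (Ug (\<psi> t))) < ereal (m + e)"
      using \<psi>(2) by (rule order_le_less_trans) (use e in simp)
    from Limsup_lessD[OF this] obtain T where T: "\<And>s. T \<le> s \<Longrightarrow> Ug (\<psi> s) < m + e"
      unfolding eventually_at_top_linorder by auto
    have "Ug (\<phi> s) < m + e" if s: "t + max T 0 \<le> s" for s
    proof -
      have "\<phi> (t + (s - t)) = \<psi> (s - t)"
        using s by (intro unique[OF forward_solution_shift[OF \<phi> t(1)] \<psi>(1)]) auto
      then show ?thesis using T[of "s - t"] s by simp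
    qed
    then show ?thesis unfolding eventually_at_top_linorder by blast
  qed
  have bounded_sol: "\<exists>r. \<forall>t\<ge>0. norm (\<phi> t) \<le> r" if \<phi>: "forward_solution h y \<phi>" for y \<phi>
  proof -
    obtain T where T: "\<And>t. T \<le> t \<Longrightarrow> Ug (\<phi> t) < m + 1"
      using Ug_limsup[OF \<phi>, of 1] unfolding eventually_at_top_linorder by auto
    obtain r1 where r1: "\<And>y. Ug y \<le> m + 1 \<Longrightarrow> norm y < r1"
      using proper_sublevel_bounded[OF Ug_props(2,1)] by blast
    obtain r2 where r2: "\<And>t. t \<in> {0..T} \<Longrightarrow> norm (\<phi> t) \<le> r2"
      using forward_solution_bounded_on[OF \<phi>] by blast
    have "norm (\<phi> t) \<le> max r1 r2" if "0 \<le> t" for t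
      using r1[OF less_imp_le[OF T[of t]]] r2[of t] that by (cases "T \<le> t") auto
    then show ?thesis by blast
  qed
  define Q where "Q = - {0} \<inter> divergence_at (\<lambda>y. \<rho> y *\<^sub>R h y) -` {0<..}"
  have hC1: "C1_on (- {0}) h"
    using h by (rule C1_on_subset) simp
  have G: "C1_on (- {0}) (\<lambda>y. \<rho> y *\<^sub>R h y)"
    by (rule C1_on_scaleR[OF \<rho>(1) hC1])
  have "open Q"
    unfolding Q_def by (intro continuous_open_preimage C1_on_continuous_on_divergence[OF G]) auto
  \<comment> \<open>The support is taken relative to \<open>- {0}\<close>, so the inclusion of
    \<open>R\<close> in it also keeps the origin out of \<open>R\<close>.\<close>
  have RQ: "R \<subseteq> Q"
    using supp div by (auto simp: R_def Q_def support_on_def)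
  obtain r0 where r0: "\<And>y. Ug y \<le> m \<Longrightarrow> norm y < r0"
    using proper_sublevel_bounded[OF Ug_props(2,1)] by blast
  have R: "compact R"
    unfolding R_def density_region_def compact_closure
    by (rule bounded_subset[OF bounded_ball[of 0 r0]]) (use r0 in auto)
  obtain \<eta> where \<eta>: "0 < \<eta>" "(\<Union>x\<in>R. ball x \<eta>) \<subseteq> Q"
    using compact_subset_open_imp_ball_epsilon_subset[OF R \<open>open Q\<close> RQ] by blast
  \<comment> \<open>The closed neighbourhood of radius \<open>\<eta> / 2\<close>, written as a sum
    of compact sets to inherit compactness.\<close>
  define K where "K = {x + v | x v. x \<in> R \<and> v \<in> cball 0 (\<eta> / 2)}"
  have K: "compact K" unfolding K_def by (intro compact_sums R compact_cball)
  have KQ: "K \<subseteq> Q"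
  proof
    fix y assume "y \<in> K"
    then obtain x v where "x \<in> R" "y = x + v" "norm v \<le> \<eta> / 2" by (auto simp: K_def)
    then have "y \<in> ball x \<eta>" using \<eta>(1) by (simp add: dist_norm)
    then show "y \<in> Q" using \<eta>(2) \<open>x \<in> R\<close> by blast
  qed
  have trapped: "\<exists>n::nat. \<forall>t\<ge>real n. \<phi> t \<in> K" if \<phi>: "forward_solution h y \<phi>" and bad: "\<not> conv \<phi>" for y \<phi>
  proof (rule ccontr)
    assume "\<not> ?thesis"
    then have "\<forall>n::nat. \<exists>t\<ge>real n. \<phi> t \<notin> K" by blast
    then obtain T where T: "\<And>n. real n \<le> T n" "\<And>n. \<phi> (T n) \<notin> K" by metis
    have T0: "0 \<le> T n" for n using T(1)[of n] by linarith
    have T_lim: "filterlim T at_top sequentially"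
      by (rule filterlim_at_top_mono[OF filterlim_real_sequentially]) (use T(1) in simp)
    have above: "M < ereal (Ul (\<phi> t))" if "0 \<le> t" for t
      using basin_later[OF \<phi> that] bad by force
    obtain r1 where r1: "\<And>t. 0 \<le> t \<Longrightarrow> norm (\<phi> t) \<le> r1"
      using bounded_sol[OF \<phi>] by blast
    have "\<forall>n. \<phi> (T n) \<in> cball 0 r1" using r1[OF T0] by simp
    then obtain p \<sigma> where \<sigma>: "strict_mono \<sigma>" and p: "((\<lambda>n. \<phi> (T n)) \<circ> \<sigma>) \<longlonglongrightarrow> p"
      using compact_imp_seq_compact[OF compact_cball] unfolding seq_compact_def by meson
    then have p: "(\<lambda>n. \<phi> (T (\<sigma> n))) \<longlonglongrightarrow> p" by (simp add: o_def)
    have "p \<notin> R"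
    proof
      assume "p \<in> R"
      have "\<forall>\<^sub>F n in sequentially. dist (\<phi> (T (\<sigma> n))) p < \<eta> / 2"
        using tendstoD[OF p, of "\<eta> / 2"] \<eta>(1) by simp
      then obtain n where "dist (\<phi> (T (\<sigma> n))) p < \<eta> / 2"
        unfolding eventually_sequentially by blast
      then have "\<phi> (T (\<sigma> n)) - p \<in> cball 0 (\<eta> / 2)"
        by (simp add: dist_norm norm_minus_commute)
      then have "p + (\<phi> (T (\<sigma> n)) - p) \<in> K" unfolding K_def using \<open>p \<in> R\<close> by blast
      then show False using T(2) by simp
    qed
    have isCont: "isCont Ul x" "isCont Ug x" for x
      using Ul_cont Ug_cont by (auto simp: continuous_on_eq_continuous_at)
    have "Ug p \<le> m + e" if "0 < e" for e
    proof (rule tendsto_upperbound[OF isCont_tendsto_compose[OF isCont(2) p]])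
      have "filterlim (\<lambda>n. T (\<sigma> n)) at_top sequentially"
        by (rule filterlim_compose[OF T_lim filterlim_subseq[OF \<sigma>]])
      from eventually_compose_filterlim[OF Ug_limsup[OF \<phi> that] this]
      show "\<forall>\<^sub>F n in sequentially. Ug (\<phi> (T (\<sigma> n))) \<le> m + e"
        by eventually_elim simp
    qed simp
    then have "Ug p \<le> m" by (rule field_le_epsilon)
    \<comment> \<open>No contradiction with \<open>above\<close> yet: the strict bounds along the
      sequence pass to the limit only as \<open>M \<le> Ul p\<close>, so \<open>p\<close> may lie
      exactly on the level \<open>M\<close>.\<close>
    then have "ereal (Ul p) \<le> M"
      using \<open>p \<notin> R\<close> closure_subset[of "{y. Ug y \<le> m} - {y. ereal (Ul y) \<le> M}"]
      by (auto simp: R_def density_region_def)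
    obtain \<xi> where \<xi>: "forward_solution h p \<xi>" using ex by blast
    have \<xi>0: "(\<xi> \<longlongrightarrow> 0) at_top"
      using basin[OF \<xi> \<open>ereal (Ul p) \<le> M\<close>] tendsto_norm_zero_cancel by (simp add: conv_def tendsto_norm_zero_iff)
    \<comment> \<open>A real level strictly below \<open>M\<close>: the solution from
      \<open>p\<close> falls under it at some time \<open>s\<close>, and by continuous dependence so
      does the bad solution started close enough to \<open>p\<close>.\<close>
    obtain M' where M': "0 < M'" "ereal M' < M"
      using ereal_dense2[OF M] by (auto simp: zero_ereal_def)
    have "((\<lambda>s. Ul (\<xi> s)) \<longlongrightarrow> Ul 0) at_top"
      by (rule isCont_tendsto_compose[OF isCont(1) \<xi>0])
    then have "\<forall>\<^sub>F s in at_top. Ul (\<xi> s) < M'"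
      using M'(1) Ul0 by (intro order_tendstoD(2)) auto
    from eventually_conj[OF this eventually_ge_at_top[of "0 :: real"]]
    obtain s where s: "0 \<le> s" "Ul (\<xi> s) < M'"
      using eventually_happens'[OF trivial_limit_at_top_linorder] by blast
    obtain r2 where r2: "\<And>t. t \<in> {0..s} \<Longrightarrow> norm (\<xi> t) \<le> r2"
      using forward_solution_bounded_on[OF \<xi>] by blast
    obtain L where L: "L-lipschitz_on (cball 0 (max r1 r2)) h" using lip by blast
    have "norm (\<phi> (T (\<sigma> n) + s) - \<xi> s) \<le> exp (L * s) * norm (\<phi> (T (\<sigma> n)) - p)" for n
      using T0[of "\<sigma> n"] r1 r2
      by (intro forward_solutions_dist_le(1)[OF L forward_solution_shift[OF \<phi> T0] \<xi> s(1)])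
        (auto simp: le_max_iff_disj)
    moreover have "(\<lambda>n. exp (L * s) * norm (\<phi> (T (\<sigma> n)) - p)) \<longlonglongrightarrow> 0"
      using p by (intro tendsto_mult_right_zero tendsto_norm_zero) (simp add: LIM_zero_iff)
    ultimately have "(\<lambda>n. \<phi> (T (\<sigma> n) + s) - \<xi> s) \<longlonglongrightarrow> 0"
      by (rule Lim_null_comparison[OF always_eventually[OF allI]])
    then have "(\<lambda>n. \<phi> (T (\<sigma> n) + s)) \<longlonglongrightarrow> \<xi> s" by (simp add: LIM_zero_iff)
    from order_tendstoD(2)[OF isCont_tendsto_compose[OF isCont(1) this] s(2)]
    obtain n where "Ul (\<phi> (T (\<sigma> n) + s)) < M'"
      unfolding eventually_sequentially by blast
    then have "ereal (Ul (\<phi> (T (\<sigma> n) + s))) < M"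
      using M'(2) by (metis ereal_less_eq(3) less_imp_le order_le_less_trans)
    then show False using above[of "T (\<sigma> n) + s"] T0[of "\<sigma> n"] s(1) by (simp add: order_less_asym)
  qed
  define S where "S = {y. \<exists>\<phi>. forward_solution h y \<phi> \<and> (\<forall>t\<ge>0. \<phi> t \<in> K)}"
  have S: "compact S" unfolding S_def by (rule compact_forward_trapped[OF lip ex K])
  have SK: "S \<subseteq> K" by (auto simp: S_def forward_solution_def)
  have later_S: "\<phi> t \<in> S" if \<phi>: "forward_solution h y \<phi>" and t: "0 \<le> t" and in_K: "\<And>s. t \<le> s \<Longrightarrow> \<phi> s \<in> K" for y \<phi> t
    unfolding S_def using forward_solution_shift[OF \<phi> t] in_K by force
  have "negligible S"
  proof (rule negligible_compact_invariant_set[OF lip S \<open>open Q\<close>])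
    show "S \<subseteq> Q" using SK KQ by blast
    have Q0: "Q \<subseteq> - {0}" by (auto simp: Q_def)
    show "continuous_on Q \<rho>"
      by (rule continuous_on_subset[OF C1_on_continuous_on[OF \<rho>(1)] Q0])
    show "0 \<le> \<rho> y" if "y \<in> Q" for y by (rule \<rho>(2)) (use Q0 that in auto)
    show "C1_on Q (\<lambda>y. \<rho> y *\<^sub>R h y)"
      by (rule C1_on_subset[OF G Q0])
    show "0 < divergence_at (\<lambda>y. \<rho> y *\<^sub>R h y) y" if "y \<in> S" for y
      using that SK KQ by (auto simp: Q_def)
    fix p assume "p \<in> S"
    then obtain \<phi> where \<phi>: "forward_solution h p \<phi>" "\<And>t. 0 \<le> t \<Longrightarrow> \<phi> t \<in> K" by (auto simp: S_def)
    then show "\<exists>\<phi>. forward_solution h p \<phi> \<and> (\<forall>t\<ge>0. \<phi> t \<in> S)"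
      using later_S[OF \<phi>(1)] by (intro exI[of _ \<phi>]) auto
  qed
  \<comment> \<open>\<open>n\<close> is a time by which the solution has entered \<open>S\<close>;
    \<open>j\<close> bounds it up to then, so that a single Lipschitz constant of \<open>h\<close>
    serves each piece of this countable cover.\<close>
  define A where "A j n = {y. \<exists>\<phi>. forward_solution h y \<phi> \<and> (\<forall>t\<in>{0..real n}. norm (\<phi> t) \<le> real j) \<and> \<phi> (real n) \<in> S}" for j n
  have A: "negligible (A j n)" for j n
  proof -
    obtain L where "L-lipschitz_on (cball 0 (real j)) h" using lip by blast
    then show ?thesis
      unfolding A_def by (rule negligible_forward_preimage[OF _ \<open>negligible S\<close>]) simp
  qed
  define Z where "Z = (\<Union>j. \<Union>n. A j n)"
  have "negligible Z"
    unfolding Z_def by (intro negligible_Union_nat A)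
  then have "Z \<in> null_sets lebesgue" by (simp add: negligible_iff_null_sets)
  moreover have "\<exists>\<phi>. forward_solution h y \<phi> \<and> ((\<lambda>t. norm (\<phi> t)) \<longlongrightarrow> 0) at_top" if y: "y \<notin> Z" for y
  proof -
    obtain \<phi> where \<phi>: "forward_solution h y \<phi>" using ex by blast
    have "conv \<phi>"
    proof (rule ccontr)
      assume bad: "\<not> conv \<phi>"
      obtain n :: nat where n: "\<And>t. real n \<le> t \<Longrightarrow> \<phi> t \<in> K" using trapped[OF \<phi> bad] by blast
      obtain r where r: "\<And>t. 0 \<le> t \<Longrightarrow> norm (\<phi> t) \<le> r" using bounded_sol[OF \<phi>] by blast
      obtain j :: nat where "r \<le> real j" using real_arch_simple by blast
      then have "norm (\<phi> t) \<le> real j" if "0 \<le> t" for t using r[OF that] by linarith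
      then have "y \<in> A j n"
        unfolding A_def using \<phi> later_S[OF \<phi> _ n] by auto
      then show False using y by (auto simp: Z_def)
    qed
    with \<phi> show ?thesis by (auto simp: conv_def)
  qed
  ultimately show ?thesis
    using stable unfolding almost_globally_asymptotically_stable_def by blast
qed

section \<open>The levels of the two gain conditions, and the conclusion\<close>

lemma lower_level_0:
  assumes "class_Kinf \<gamma>"
  shows "lower_level \<gamma> 0 0 = 0"
proof -
  have "the_inv_into {0..} \<gamma> 0 = 0"
    using assms by (intro the_inv_into_f_eq) (auto simp: class_Kinf_def intro: strict_mono_on_imp_inj_on)
  then show ?thesis by (simp add: lower_level_def Kinf_inverse_def)
qed

lemma upper_level_pos:
  assumes \<delta>: "class_Kinf \<delta>" and M: "0 < M" and N: "0 < N"
  shows "0 < upper_level \<delta> M N"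
proof -
  have "0 < Kinf_extend \<delta> M"
    using M class_Kinf_pos[OF \<delta>] by (cases M) (auto simp: Kinf_extend_def)
  then show ?thesis using N by (simp add: upper_level_def)
qed

theorem theorem3p6:
  fixes f :: "(real ^ 'n) \<times> (real ^ 'm) \<Rightarrow> real ^ 'n"
    and g :: "(real ^ 'n) \<times> (real ^ 'm) \<Rightarrow> real ^ 'm"
    and V lam_x :: "real ^ 'n \<Rightarrow> real"
    and W lam_z :: "real ^ 'm \<Rightarrow> real"
    and M\<^sub>l N\<^sub>l :: ereal
    and M\<^sub>g N\<^sub>g :: real
    and \<gamma>\<^sub>l \<delta>\<^sub>l \<gamma>\<^sub>g \<delta>\<^sub>g :: "real \<Rightarrow> real"
    and U\<^sub>l U\<^sub>g :: "(real ^ 'n) \<times> (real ^ 'm) \<Rightarrow> real"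
  assumes "C1_on UNIV f" and "C1_on UNIV g"
    and "input_to_state_stable (\<lambda>x u. f (x, u))"
    and "input_to_state_stable (\<lambda>z v. g (v, z))"
    and "iss_lyapunov_pair f g V W lam_x lam_z"
    and local_data: "region_gain_condition f g V W lam_x lam_z 0 M\<^sub>l 0 N\<^sub>l \<gamma>\<^sub>l \<delta>\<^sub>l"
      "M\<^sub>l < \<infinity> \<or> N\<^sub>l < \<infinity>"
    and nonlocal_data: "region_gain_condition f g V W lam_x lam_z M\<^sub>g \<infinity> N\<^sub>g \<infinity> \<gamma>\<^sub>g \<delta>\<^sub>g"
      "M\<^sub>g > 0 \<or> N\<^sub>g > 0"
    and "M\<^sub>l < ereal M\<^sub>g \<or> N\<^sub>l < ereal N\<^sub>g"
    and "region_lyapunov_function (interconnection f g)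
           (lower_level \<gamma>\<^sub>l 0 0) (upper_level \<delta>\<^sub>l M\<^sub>l N\<^sub>l) U\<^sub>l"
    and "region_lyapunov_function (interconnection f g)
           (lower_level \<gamma>\<^sub>g M\<^sub>g N\<^sub>g) (upper_level \<delta>\<^sub>g \<infinity> \<infinity>) U\<^sub>g"
    and "\<exists>\<rho> :: (real ^ 'n) \<times> (real ^ 'm) \<Rightarrow> real.
           C1_on (- {0}) \<rho> \<and> (\<forall>y. y \<noteq> 0 \<longrightarrow> 0 \<le> \<rho> y) \<and>
           density_region U\<^sub>l (upper_level \<delta>\<^sub>l M\<^sub>l N\<^sub>l) U\<^sub>g (lower_level \<gamma>\<^sub>g M\<^sub>g N\<^sub>g)
             \<subseteq> support_on (- {0}) \<rho> \<and>
           (\<forall>y \<in> density_region U\<^sub>l (upper_level \<delta>\<^sub>l M\<^sub>l N\<^sub>l) U\<^sub>g (lower_level \<gamma>\<^sub>g M\<^sub>g N\<^sub>g).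
              divergence_at (\<lambda>y. \<rho> y *\<^sub>R interconnection f g y) y > 0)"
  shows "almost_globally_asymptotically_stable (interconnection f g)"
proof -
  have h: "C1_on UNIV (interconnection f g)"
    unfolding interconnection_def by (rule C1_on_Pair[OF assms(1,2)])
  have K: "class_Kinf \<gamma>\<^sub>l" "class_Kinf \<delta>\<^sub>l" and pos: "0 < M\<^sub>l" "0 < N\<^sub>l"
    using local_data(1) by (auto simp: region_gain_condition_def zero_ereal_def)
  \<comment> \<open>For the local data the lower level is \<open>0\<close>, so the limsup bound
    means convergence to the origin; for the nonlocal data the upper level is infinite, so every
    point above the lower level is attracted.\<close>
  have Ul: "region_lyapunov_function (interconnection f g) 0 (upper_level \<delta>\<^sub>l M\<^sub>l N\<^sub>l) U\<^sub>l"
    using assms(11) by (simp add: lower_level_0[OF K(1)])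
  have Ug: "region_lyapunov_function (interconnection f g) (lower_level \<gamma>\<^sub>g M\<^sub>g N\<^sub>g) \<infinity> U\<^sub>g"
    using assms(12) by (simp add: upper_level_def Kinf_extend_def)
  have "lyapunov_stable (interconnection f g)"
    using assms(5) local_data(1) forward_solution_exists_of_region_lyapunov[OF h Ug]
    by (rule gain_condition_imp_lyapunov_stable)
  with assms(13) upper_level_pos[OF K(2) pos] show ?thesis
    using almost_global_stability_of_density[OF h _ Ul _ Ug] by blast
qed

end
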